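(* Let $n\ge 4$ and let $S=\{x,y,z,w\}$ be a set of four distinct vertices of $D_n$ such that the vertices of $S$ lie in exactly two clusters of $D_n$. Then there exist $n-1$ internally disjoint $S$-trees in $D_n$.
   Context: The $n$-dimensional dual cube $D_n$ has vertex set all $(2n-1)$-bit binary strings $u_1u_2\cdots u_{2n-1}$. Two vertices $u,v$ are adjacent iff they differ in exactly one bit position $i$, and moreover: if $1\le i\le n-1$ then $u_{2n-1}=v_{2n-1}=0$; if $n\le i\le 2n-2$ then $u_{2n-1}=v_{2n-1}=1$; (if $i=2n-1$ there is no further condition). A cluster of class $0$ is a set of all vertices with last bit $0$ and a fixed value of the bits in positions $n,\dots,2n-2$; a cluster of class $1$ is a set of all vertices with last bit $1$ and a fixed value of the bits in positions $1,\dots,n-1$. The clusters partition $V(D_n)$. For $S\subseteq V(G)$, an $S$-tree is a subtree of $G$ whose vertex set contains $S$; a family of $S$-trees $T_1,\dots,T_m$ is internally disjoint if the trees are pairwise edge-disjoint and $V(T_i)\cap V(T_j)=S$ for all $i\ne j$. *)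

theory Defs
  imports Main
begin

text \<open>Vertices of the dual cube D_n: bit lists of length 2n-1.
  Bit number i (1-based, as in the paper) of u is u ! (i - 1);
  the last bit u_{2n-1} is u ! (2n-2).\<close>

definition bit :: "bool list \<Rightarrow> nat \<Rightarrow> bool" where
  "bit u i = u ! (i - 1)"

definition dc_verts :: "nat \<Rightarrow> bool list set" where
  "dc_verts n = {u. length u = 2*n - 1}"

definition dc_adj :: "nat \<Rightarrow> bool list \<Rightarrow> bool list \<Rightarrow> bool" where
  "dc_adj n u v \<longleftrightarrow> u \<in> dc_verts n \<and> v \<in> dc_verts n \<and>
     (\<exists>i\<in>{1..2*n-1}. bit u i \<noteq> bit v i \<and>
        (\<forall>j\<in>{1..2*n-1}. j \<noteq> i \<longrightarrow> bit u j = bit v j) \<and>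
        (1 \<le> i \<and> i \<le> n - 1 \<longrightarrow> \<not> bit u (2*n-1) \<and> \<not> bit v (2*n-1)) \<and>
        (n \<le> i \<and> i \<le> 2*n - 2 \<longrightarrow> bit u (2*n-1) \<and> bit v (2*n-1)))"

definition dc_edges :: "nat \<Rightarrow> bool list set set" where
  "dc_edges n = {{u, v} | u v. dc_adj n u v}"

definition cluster :: "nat \<Rightarrow> bool list \<Rightarrow> bool list set" where
  "cluster n u = {v \<in> dc_verts n. bit v (2*n-1) = bit u (2*n-1) \<and>
     (if \<not> bit u (2*n-1) then (\<forall>i\<in>{n..2*n-2}. bit v i = bit u i)
      else (\<forall>i\<in>{1..n-1}. bit v i = bit u i))}"

definition connected_graph :: "'a set \<Rightarrow> 'a set set \<Rightarrow> bool" where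
  "connected_graph VT ET \<longleftrightarrow> VT \<noteq> {} \<and>
     (\<forall>u\<in>VT. \<forall>v\<in>VT. (\<lambda>x y. {x, y} \<in> ET)\<^sup>*\<^sup>* u v)"

definition has_cycle :: "'a set set \<Rightarrow> bool" where
  "has_cycle ET \<longleftrightarrow> (\<exists>cs. length cs \<ge> 3 \<and> distinct cs \<and>
     (\<forall>i < length cs. {cs ! i, cs ! ((i + 1) mod length cs)} \<in> ET))"

definition is_tree :: "'a set \<Rightarrow> 'a set set \<Rightarrow> bool" where
  "is_tree VT ET \<longleftrightarrow> finite VT \<and> (\<forall>e\<in>ET. \<exists>u v. u \<noteq> v \<and> e = {u, v} \<and> u \<in> VT \<and> v \<in> VT)
     \<and> connected_graph VT ET \<and> \<not> has_cycle ET"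

definition is_S_tree :: "nat \<Rightarrow> bool list set \<Rightarrow> bool list set \<Rightarrow> bool list set set \<Rightarrow> bool" where
  "is_S_tree n S VT ET \<longleftrightarrow> VT \<subseteq> dc_verts n \<and> ET \<subseteq> dc_edges n \<and> is_tree VT ET \<and> S \<subseteq> VT"

definition internally_disjoint_S_trees ::
  "nat \<Rightarrow> bool list set \<Rightarrow> nat \<Rightarrow> (nat \<Rightarrow> bool list set) \<Rightarrow> (nat \<Rightarrow> bool list set set) \<Rightarrow> bool" where
  "internally_disjoint_S_trees n S m TV TE \<longleftrightarrow>
     (\<forall>i<m. is_S_tree n S (TV i) (TE i)) \<and>
     (\<forall>i<m. \<forall>j<m. i \<noteq> j \<longrightarrow> TE i \<inter> TE j = {} \<and> TV i \<inter> TV j = S)"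

end

theory Submission
  imports Defs
begin

text \<open>Let \<open>d = n - 1\<close>. Every cluster is a \<open>d\<close>-dimensional cube, and any two clusters of opposite
  class are joined by exactly one edge, so every family of clusters that contains both classes is
  connected. It therefore suffices to build, inside each of the two clusters that meet \<open>S\<close>, \<open>d\<close>
  internally disjoint pieces such that every vertex of \<open>S\<close> and of the piece reaches, within the
  piece, an exit whose cross edge leads to a cluster reserved for that piece. A single \<open>d\<close>-fold
  fan from the neighbours of one vertex to another gives the pieces for one or two vertices. For
  three vertices \<open>x, y, z\<close> a fan between \<open>x\<close> and \<open>y\<close> is combined with one neighbour of \<open>z\<close> per
  piece, which works as soon as \<open>z\<close> differs from both \<open>x\<close> and \<open>y\<close> in two coordinates; up to the
  choice of \<open>z\<close> and a translation the only other configurations are three unit vectors, or two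
  unit vectors and the origin. If the two clusters have the same class, the exits of the two
  systems are aligned so that exits of different pieces never lead to the same cluster; if the
  classes differ, it is enough that no exit leads directly into the other cluster.\<close>

subsection \<open>Reachability and spanning trees\<close>

definition reach :: "'a set set \<Rightarrow> 'a \<Rightarrow> 'a \<Rightarrow> bool" where
  "reach A = (\<lambda>x y. {x, y} \<in> A)\<^sup>*\<^sup>*"

lemma reach_refl [simp, intro]: "reach A u u"
  by (simp add: reach_def)

lemma reach_trans [trans]: "reach A u v \<Longrightarrow> reach A v w \<Longrightarrow> reach A u w"
  unfolding reach_def by (rule rtranclp_trans)

lemma reach_edge: "{u, v} \<in> A \<Longrightarrow> reach A u v"
  unfolding reach_def by (rule r_into_rtranclp)

lemma reach_induct [consumes 1, case_names refl step]:
  assumes "reach A u v" "P u" "\<And>x y. reach A u x \<Longrightarrow> {x, y} \<in> A \<Longrightarrow> P x \<Longrightarrow> P y"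
  shows "P v"
  using assms(1) unfolding reach_def
  by (induction rule: rtranclp_induct) (use assms(2,3) in \<open>auto simp: reach_def\<close>)

lemma reach_sym: "reach A u v \<Longrightarrow> reach A v u"
proof (induction rule: reach_induct)
  case (step x y)
  from step(2) have "reach A y x"
    by (intro reach_edge) (simp only: insert_commute)
  then show ?case
    using step(3) by (rule reach_trans)
qed simp

text \<open>A walk is transported edge by edge, and the image of an edge may itself be a walk. This
  covers enlarging the edge set, mapping the vertices, and rerouting around a deleted edge.\<close>

lemma reach_transfer:
  assumes "reach A u v" "\<And>x y. {x, y} \<in> A \<Longrightarrow> reach B (f x) (f y)"
  shows "reach B (f u) (f v)"
  using assms(1)
proof (induction rule: reach_induct)
  case (step x y)
  then show ?case
    using assms(2) by (blast intro: reach_trans)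
qed simp

lemma reach_mono: "reach A u v \<Longrightarrow> A \<subseteq> B \<Longrightarrow> reach B u v"
  by (rule reach_transfer[where f = "\<lambda>x. x"], assumption, rule reach_edge, erule (1) rev_subsetD)

lemma reach_image: "reach A u v \<Longrightarrow> (\<lambda>e. f ` e) ` A \<subseteq> B \<Longrightarrow> reach B (f u) (f v)"
  by (rule reach_transfer[where f = f], assumption, rule reach_edge)
    (metis (no_types) image_empty image_insert image_subset_iff)

lemma connected_graph_reach:
  "connected_graph VT A \<longleftrightarrow> VT \<noteq> {} \<and> (\<forall>u\<in>VT. \<forall>v\<in>VT. reach A u v)"
  by (simp add: connected_graph_def reach_def)

text \<open>The two ends of a cycle edge remain joined by the rest of the cycle, so any walk using
  the edge can take that detour.\<close>

lemma cycle_edge_redundant: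
  assumes "has_cycle B"
  obtains e where "e \<in> B" "\<And>u v. reach B u v \<Longrightarrow> reach (B - {e}) u v"
proof -
  obtain cs where cs: "length cs \<ge> 3" "distinct cs"
    and edge: "\<And>i. i < length cs \<Longrightarrow> {cs ! i, cs ! ((i + 1) mod length cs)} \<in> B"
    using assms by (auto simp: has_cycle_def)
  define e where "e = {cs ! 0, cs ! 1}"
  let ?l = "length cs"
  have eB: "e \<in> B"
  proof -
    have "1 mod length cs = 1" "0 < length cs"
      using cs(1) by (simp, cases cs, auto)
    then show ?thesis
      using edge[of 0] by (simp add: e_def)
  qed
  have neq: "cs ! i \<noteq> cs ! j" if "i < ?l" "j < ?l" "i \<noteq> j" for i j
    using cs(2) that by (simp add: nth_eq_iff_index_eq)
  \<comment> \<open>An edge with an end of index at least 2 differs from \<open>e\<close>, because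
    the entries of \<open>cs\<close> are distinct.\<close>
  have other: "{cs ! i, cs ! j} \<in> B - {e}" if "{cs ! i, cs ! j} \<in> B" "i \<ge> 2" "i < ?l" for i j
  proof -
    have "cs ! i \<noteq> cs ! 0" "cs ! i \<noteq> cs ! 1"
      using that(2,3) cs(1) by (intro neq; linarith)+
    then show ?thesis
      using that(1) by (auto simp: e_def doubleton_eq_iff)
  qed
  \<comment> \<open>The detour runs up from index 1 to the last index; the closing edge then leads
    to index 0.\<close>
  have walk: "k + 1 < ?l \<Longrightarrow> reach (B - {e}) (cs ! 1) (cs ! (k + 1))" for k
  proof (induction k)
    case (Suc k)
    have "{cs ! (k + 2), cs ! (k + 1)} \<in> B"
      using edge[of "k + 1"] Suc.prems by (simp add: insert_commute)
    then have "reach (B - {e}) (cs ! (k + 1)) (cs ! (k + 2))"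
      using other[of "k + 2" "k + 1"] Suc.prems by (intro reach_sym[OF reach_edge]) simp
    with Suc show ?case
      using reach_trans by fastforce
  qed simp
  have "{cs ! (?l - 1), cs ! 0} \<in> B"
    using edge[of "?l - 1"] cs(1) by (cases cs) auto
  then have "reach (B - {e}) (cs ! (?l - 1)) (cs ! 0)"
    using other[of "?l - 1" 0] cs(1) by (intro reach_edge) simp
  moreover have "reach (B - {e}) (cs ! 1) (cs ! (?l - 1))"
    using walk[of "?l - 2"] cs(1) by (simp add: numeral_2_eq_2 Suc_diff_Suc)
  ultimately have around: "reach (B - {e}) (cs ! 1) (cs ! 0)"
    by (blast intro: reach_trans)
  have "reach (B - {e}) u v" if "reach B u v" for u v
  proof (rule reach_transfer[where f = "\<lambda>x. x", OF that])
    fix x y assume xy: "{x, y} \<in> B"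
    show "reach (B - {e}) x y"
    proof (cases "{x, y} = e")
      case True
      then show ?thesis
        using around reach_sym[OF around] by (auto simp: e_def doubleton_eq_iff)
    qed (use xy in \<open>auto intro: reach_edge\<close>)
  qed
  with eB show thesis
    by (rule that)
qed

text \<open>A connected edge subset of least cardinality has no cycle, since a cycle edge could
  still be dropped. Hence the construction only has to produce connected pieces; trees are extracted
  at the very end.\<close>

lemma spanning_tree_exists:
  assumes "finite VT" "connected_graph VT A"
    and edges: "\<And>e. e \<in> A \<Longrightarrow> \<exists>u v. u \<noteq> v \<and> e = {u, v} \<and> u \<in> VT \<and> v \<in> VT"
  shows "\<exists>ET\<subseteq>A. is_tree VT ET"
proof -
  have "A \<subseteq> Pow VT"
    using edges by fastforce
  then have finA: "finite A"
    using assms(1) by (simp add: finite_subset)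
  define P where "P B \<longleftrightarrow> B \<subseteq> A \<and> connected_graph VT B" for B
  have "P A"
    using assms(2) by (simp add: P_def)
  from ex_has_least_nat[of P, OF this, of card]
  obtain B where "P B" and min: "\<And>C. P C \<Longrightarrow> card B \<le> card C"
    by blast
  then have B: "B \<subseteq> A" "connected_graph VT B"
    by (simp_all add: P_def)
  have "\<not> has_cycle B"
  proof
    assume "has_cycle B"
    then obtain e where e: "e \<in> B" "\<And>u v. reach B u v \<Longrightarrow> reach (B - {e}) u v"
      by (rule cycle_edge_redundant) blast
    then have "P (B - {e})"
      using B by (auto simp: P_def connected_graph_reach)
    moreover have "card (B - {e}) < card B"
      using e(1) B finA by (meson card_Diff1_less finite_subset)
    ultimately show False
      using min[of "B - {e}"] by simp
  qed
  moreover have "\<forall>e\<in>B. \<exists>u v. u \<noteq> v \<and> e = {u, v} \<and> u \<in> VT \<and> v \<in> VT"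
    using edges B(1) by (intro ballI) (erule (1) rev_subsetD[THEN edges])
  ultimately have "is_tree VT B"
    using B(2) assms(1) by (simp add: is_tree_def)
  with B(1) show ?thesis
    by (intro exI[of _ B] conjI)
qed

subsection \<open>Systems of connecting pieces with exits\<close>

text \<open>The pieces have exactly \<open>X\<close> in common: \<open>W i\<close> holds the private
  vertices and \<open>A i\<close> the edges of piece \<open>i\<close>. Connectedness is kept
  separate, because a piece inside one cluster may fall apart and be joined up outside of
  it.\<close>

definition system ::
  "('a \<Rightarrow> 'a \<Rightarrow> bool) \<Rightarrow> 'a set \<Rightarrow> nat \<Rightarrow> 'a set \<Rightarrow> (nat \<Rightarrow> 'a set) \<Rightarrow> (nat \<Rightarrow> 'a set set) \<Rightarrow> bool"
  where
  "system adj V m X W A \<longleftrightarrow> X \<subseteq> V \<and>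
     (\<forall>i<m. W i \<subseteq> V - X \<and> A i \<subseteq> {{u, v} | u v. adj u v \<and> u \<in> X \<union> W i \<and> v \<in> X \<union> W i}) \<and>
     (\<forall>i<m. \<forall>j<m. i \<noteq> j \<longrightarrow> W i \<inter> W j = {} \<and> A i \<inter> A j = {})"

text \<open>An exit is a vertex whose cross edge the piece uses to leave the cluster. A vertex of
  \<open>X\<close> may be an exit too, but of one piece only, since its cross edge can be used only
  once.\<close>

definition exits ::
  "nat \<Rightarrow> 'a set \<Rightarrow> (nat \<Rightarrow> 'a set) \<Rightarrow> (nat \<Rightarrow> 'a set set) \<Rightarrow> (nat \<Rightarrow> 'a set) \<Rightarrow> bool" where
  "exits m X W A E \<longleftrightarrow>
     (\<forall>i<m. E i \<subseteq> X \<union> W i \<and> (\<forall>v \<in> X \<union> W i. \<exists>e\<in>E i. reach (A i) v e)) \<and>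
     (\<forall>i<m. \<forall>j<m. i \<noteq> j \<longrightarrow> E i \<inter> E j = {})"

text \<open>The edges between \<open>W\<close> and \<open>X \<union> W\<close>; edges inside \<open>X\<close> are left out because disjoint
  pieces would otherwise share them.\<close>

definition piece :: "('a \<Rightarrow> 'a \<Rightarrow> bool) \<Rightarrow> 'a set \<Rightarrow> 'a set \<Rightarrow> 'a set set" where
  "piece adj X W = {{u, v} | u v. adj u v \<and> u \<in> W \<and> v \<in> X \<union> W}"

lemma pieceI: "adj u v \<Longrightarrow> u \<in> W \<Longrightarrow> v \<in> X \<union> W \<Longrightarrow> {u, v} \<in> piece adj X W"
  by (auto simp: piece_def)

lemma piece_mono: "X \<subseteq> X' \<Longrightarrow> W \<subseteq> W' \<Longrightarrow> piece adj X W \<subseteq> piece adj X' W'"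
  unfolding piece_def by (intro Collect_mono) blast

text \<open>Every edge of \<open>piece adj X (W i)\<close> has an end in \<open>W i\<close> and
  stays in \<open>X \<union> W i\<close>, so disjoint private vertices give disjoint edges. The
  edges inside \<open>X\<close> have no such owner and are handed out explicitly through
  \<open>F\<close>.\<close>

lemma system_pieces:
  assumes "X \<subseteq> V"
    and W: "\<And>i. i < m \<Longrightarrow> W i \<subseteq> V - X"
    and Wd: "\<And>i j. i < m \<Longrightarrow> j < m \<Longrightarrow> i \<noteq> j \<Longrightarrow> W i \<inter> W j = {}"
    and F: "\<And>i. i < m \<Longrightarrow> F i \<subseteq> {{u, v} | u v. adj u v \<and> u \<in> X \<and> v \<in> X}"
    and Fd: "\<And>i j. i < m \<Longrightarrow> j < m \<Longrightarrow> i \<noteq> j \<Longrightarrow> F i \<inter> F j = {}"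
  shows "system adj V m X W (\<lambda>i. piece adj X (W i) \<union> F i)"
proof -
  have touch: "e \<subseteq> X \<union> W i \<and> e \<inter> W i \<noteq> {}" if "e \<in> piece adj X (W i)" for e i
    using that by (auto simp: piece_def)
  have inX: "e \<subseteq> X" if "e \<in> F i" "i < m" for e i
    using F[OF that(2)] that(1) by auto
  have "(piece adj X (W i) \<union> F i) \<inter> (piece adj X (W j) \<union> F j) = {}"
    if ij: "i < m" "j < m" "i \<noteq> j" for i j
  proof -
    have "False" if "e \<in> piece adj X (W i) \<union> F i" "e \<in> piece adj X (W j) \<union> F j" for e
      using that touch[of e i] touch[of e j] inX[of e i] inX[of e j] ij
        Wd[OF ij] Fd[OF ij] W[of i] W[of j] by blast
    then show ?thesis
      by blast
  qed
  moreover have "piece adj X (W i) \<union> F i \<subseteq> {{u, v} | u v. adj u v \<and> u \<in> X \<union> W i \<and> v \<in> X \<union> W i}"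
    if "i < m" for i
    using F[OF that] by (fastforce simp: piece_def)
  ultimately show ?thesis
    using assms(1) W Wd by (simp add: system_def)
qed

text \<open>Serves three transports: translating the hypercube, placing it into a cluster, and
  encoding vertices as bit strings.\<close>

lemma system_image:
  assumes "system adj V m X W A" "inj_on f V" "f ` V \<subseteq> V'"
    and adj: "\<And>u v. adj u v \<Longrightarrow> u \<in> V \<Longrightarrow> v \<in> V \<Longrightarrow> adj' (f u) (f v)"
  shows "system adj' V' m (f ` X) (\<lambda>i. f ` W i) (\<lambda>i. (`) f ` A i)"
proof -
  have X: "X \<subseteq> V" and W: "\<And>i. i < m \<Longrightarrow> W i \<subseteq> V - X"
    and A: "\<And>i. i < m \<Longrightarrow> A i \<subseteq> {{u, v} | u v. adj u v \<and> u \<in> X \<union> W i \<and> v \<in> X \<union> W i}"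
    and d: "\<And>i j. i < m \<Longrightarrow> j < m \<Longrightarrow> i \<noteq> j \<Longrightarrow> W i \<inter> W j = {} \<and> A i \<inter> A j = {}"
    using assms(1) by (simp_all add: system_def)
  have AV: "A i \<subseteq> Pow V" if "i < m" for i
    using A[OF that] X W[OF that] by fastforce
  have "f ` W i \<subseteq> V' - f ` X" if "i < m" for i
    using W[OF that] X assms(2,3) by (fastforce dest: inj_onD)
  moreover have "(`) f ` A i \<subseteq> {{u, v} | u v. adj' u v \<and> u \<in> f ` X \<union> f ` W i \<and> v \<in> f ` X \<union> f ` W i}"
    if i: "i < m" for i
  proof
    fix e assume "e \<in> (`) f ` A i"
    then obtain e' where "e = f ` e'" "e' \<in> A i"
      by blast
    moreover from this A[OF i] obtain u v
      where "e' = {u, v}" "adj u v" "u \<in> X \<union> W i" "v \<in> X \<union> W i"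
      by (auto simp: subset_iff)
    ultimately have "e = {f u, f v}" "adj u v" "u \<in> X \<union> W i" "v \<in> X \<union> W i"
      by simp_all
    moreover from this have "adj' (f u) (f v)"
      using X W[OF i] by (intro adj) auto
    ultimately show "e \<in> {{u, v} | u v. adj' u v \<and> u \<in> f ` X \<union> f ` W i \<and> v \<in> f ` X \<union> f ` W i}"
      by (intro CollectI exI conjI) auto
  qed
  moreover have "f ` W i \<inter> f ` W j = {} \<and> (`) f ` A i \<inter> (`) f ` A j = {}"
    if "i < m" "j < m" "i \<noteq> j" for i j
  proof -
    have "f ` W i \<inter> f ` W j = f ` (W i \<inter> W j)"
      using W[OF that(1)] W[OF that(2)] by (intro inj_on_image_Int[OF assms(2), symmetric]) auto
    moreover have "(`) f ` A i \<inter> (`) f ` A j = (`) f ` (A i \<inter> A j)"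
      using AV[OF that(1)] AV[OF that(2)] inj_on_image_Pow[OF assms(2)]
      by (intro inj_on_image_Int[symmetric]) auto
    ultimately show ?thesis
      using d[OF that] by simp
  qed
  moreover have "f ` X \<subseteq> V'"
    using X assms(3) by blast
  ultimately show ?thesis
    by (simp add: system_def)
qed

lemma exits_image:
  assumes "exits m X W A E" "inj_on f V" "X \<subseteq> V" "\<And>i. i < m \<Longrightarrow> W i \<subseteq> V"
  shows "exits m (f ` X) (\<lambda>i. f ` W i) (\<lambda>i. (`) f ` A i) (\<lambda>i. f ` E i)"
proof -
  have E: "E i \<subseteq> X \<union> W i" if "i < m" for i
    using assms(1) that by (simp add: exits_def)
  have "f ` E i \<inter> f ` E j = {}" if "i < m" "j < m" "i \<noteq> j" for i j
  proof -
    have "f ` E i \<inter> f ` E j = f ` (E i \<inter> E j)"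
      using E[OF that(1)] E[OF that(2)] assms(3) assms(4)[OF that(1)] assms(4)[OF that(2)]
      by (intro inj_on_image_Int[OF assms(2), symmetric]) auto
    then show ?thesis
      using assms(1) that by (simp add: exits_def)
  qed
  moreover have "\<exists>e\<in>f ` E i. reach ((`) f ` A i) v e" if i: "i < m" and v: "v \<in> f ` X \<union> f ` W i" for i v
  proof -
    obtain u where u: "v = f u" "u \<in> X \<union> W i"
      using v by blast
    then obtain e where "e \<in> E i" "reach (A i) u e"
      using assms(1) i unfolding exits_def by blast
    then show ?thesis
      using u(1) by (blast intro: reach_image)
  qed
  ultimately show ?thesis
    using E image_mono[OF E, of _ f] by (simp add: exits_def image_Un)
qed

subsection \<open>Exit systems in the hypercube\<close>

text \<open>With subsets of \<open>{..<d}\<close> as cube vertices, translations become symmetric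
  differences and the neighbours of the origin \<open>{}\<close> become singletons.\<close>

definition flip :: "nat \<Rightarrow> nat set \<Rightarrow> nat set" where
  "flip j u = (if j \<in> u then u - {j} else insert j u)"

definition cube_adj :: "nat \<Rightarrow> nat set \<Rightarrow> nat set \<Rightarrow> bool" where
  "cube_adj d u v \<longleftrightarrow> u \<subseteq> {..<d} \<and> (\<exists>j<d. v = flip j u)"

lemma flip_flip [simp]: "flip j (flip j u) = u"
  by (auto simp: flip_def)

lemma flip_empty [simp]: "flip j {} = {j}"
  by (simp add: flip_def)

lemma flip_neq [simp]: "flip j u \<noteq> u" "u \<noteq> flip j u"
  by (auto simp: flip_def)

lemma flip_inj: "flip i u = flip j u \<longleftrightarrow> i = j"
  by (auto simp: flip_def split: if_splits)

lemma flip_subset: "j < d \<Longrightarrow> flip j u \<subseteq> {..<d} \<longleftrightarrow> u \<subseteq> {..<d}"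
  by (auto simp: flip_def)

lemma flip_sym_diff: "flip j (sym_diff t u) = sym_diff t (flip j u)"
  by (auto simp: flip_def)

lemma cube_adj_sym: "cube_adj d u v \<Longrightarrow> cube_adj d v u"
  unfolding cube_adj_def by (metis flip_flip flip_subset)

lemma cube_adj_insert: "j < d \<Longrightarrow> j \<notin> u \<Longrightarrow> u \<subseteq> {..<d} \<Longrightarrow> cube_adj d u (insert j u)"
  unfolding cube_adj_def flip_def by auto

lemma cube_adj_insert': "j < d \<Longrightarrow> j \<notin> u \<Longrightarrow> u \<subseteq> {..<d} \<Longrightarrow> cube_adj d (insert j u) u"
  by (rule cube_adj_sym[OF cube_adj_insert])

text \<open>There are as many pieces as dimensions. Of the pieces only the exits are recorded, since
  they alone matter when two clusters are joined.\<close>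

definition exitable :: "nat \<Rightarrow> nat set set \<Rightarrow> (nat \<Rightarrow> nat set set) \<Rightarrow> bool" where
  "exitable d X E \<longleftrightarrow> (\<exists>W A. system (cube_adj d) (Pow {..<d}) d X W A \<and> exits d X W A E)"

lemma sym_diff_cancel [simp]: "sym_diff t (sym_diff t u) = u"
  by blast

lemma exitable_translate:
  assumes "exitable d X E" "t \<subseteq> {..<d}"
  shows "exitable d (sym_diff t ` X) (\<lambda>i. sym_diff t ` E i)"
proof -
  obtain W A where s: "system (cube_adj d) (Pow {..<d}) d X W A" and e: "exits d X W A E"
    using assms(1) by (auto simp: exitable_def)
  have inj: "inj_on (sym_diff t) (Pow {..<d})"
    by (rule inj_on_inverseI[where g = "sym_diff t"]) simp
  have "cube_adj d (sym_diff t u) (sym_diff t v)" if "cube_adj d u v" for u v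
    using that assms(2) by (auto simp: cube_adj_def flip_sym_diff)
  then have "system (cube_adj d) (Pow {..<d}) d (sym_diff t ` X) (\<lambda>i. sym_diff t ` W i)
      (\<lambda>i. (`) (sym_diff t) ` A i)"
    using assms(2) by (intro system_image[OF s inj]) auto
  moreover have "exits d (sym_diff t ` X) (\<lambda>i. sym_diff t ` W i) (\<lambda>i. (`) (sym_diff t) ` A i)
      (\<lambda>i. sym_diff t ` E i)"
    using s by (intro exits_image[OF e inj]) (auto simp: system_def)
  ultimately show ?thesis
    unfolding exitable_def by blast
qed

lemma exitable_reindex:
  assumes "exitable d X E" "bij_betw \<sigma> {..<d} {..<d}"
  shows "exitable d X (\<lambda>i. E (\<sigma> i))"
proof -
  obtain W A where s: "system (cube_adj d) (Pow {..<d}) d X W A" and e: "exits d X W A E"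
    using assms(1) by (auto simp: exitable_def)
  have less: "\<sigma> i < d" if "i < d" for i
    using assms(2) that by (auto simp: bij_betw_def)
  have neq: "\<sigma> i \<noteq> \<sigma> j" if "i < d" "j < d" "i \<noteq> j" for i j
    using assms(2) that by (auto simp: bij_betw_def dest: inj_onD)
  have "system (cube_adj d) (Pow {..<d}) d X (\<lambda>i. W (\<sigma> i)) (\<lambda>i. A (\<sigma> i))"
    using s less neq by (simp add: system_def)
  moreover have "exits d X (\<lambda>i. W (\<sigma> i)) (\<lambda>i. A (\<sigma> i)) (\<lambda>i. E (\<sigma> i))"
    using e less neq by (simp add: exits_def)
  ultimately show ?thesis
    unfolding exitable_def by blast
qed

section \<open>Cyclic intervals and fans in the hypercube\<close>

text \<open>For \<open>i \<in> D\<close> the \<open>i\<close>-th path of the fan runs through the proper cyclic intervals of \<open>D\<close>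
  that start at \<open>i\<close>; for \<open>i \<notin> D\<close> it is replaced by the translate by \<open>i\<close> of the subcube spanned
  by \<open>D\<close>.\<close>

definition arc :: "nat \<Rightarrow> nat \<Rightarrow> nat \<Rightarrow> nat set" where
  "arc m a k = (\<lambda>t. (a + t) mod m) ` {..<k}"

lemma arc_Suc: "arc m a (Suc k) = insert ((a + k) mod m) (arc m a k)"
  by (simp add: arc_def lessThan_Suc)

lemma arc_subset: "0 < m \<Longrightarrow> arc m a k \<subseteq> {..<m}"
  by (auto simp: arc_def)

lemma add_mod_inj:
  fixes a s t m :: nat
  assumes "(a + s) mod m = (a + t) mod m" "s < m" "t < m"
  shows "s = t"
  using assms
proof (induction s t rule: linorder_wlog)
  case (le s t)
  then have "m dvd (a + t) - (a + s)"
    by (metis mod_eq_dvd_iff_nat add_le_mono order_refl)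
  then show ?case
    using le by (auto dest!: dvd_imp_le)
qed simp

lemma arc_full: "0 < m \<Longrightarrow> a < m \<Longrightarrow> arc m a m = {..<m}"
proof (rule card_subset_eq)
  assume "0 < m"
  have "inj_on (\<lambda>t. (a + t) mod m) {..<m}"
    by (rule inj_onI) (auto intro: add_mod_inj)
  then show "card (arc m a m) = card {..<m}"
    by (simp add: arc_def card_image)
qed (simp_all add: arc_subset)

text \<open>The start of a nonempty proper cyclic interval is its only member whose cyclic
  predecessor lies outside.\<close>

lemma arc_start_unique:
  assumes "a < m" "b < m" "0 < k" "k < m" "0 < l" "l < m" "arc m a k = arc m b l"
  shows "a = b"
proof (rule ccontr)
  assume "a \<noteq> b"
  have "b \<in> arc m b l"
    using assms by (auto simp: arc_def image_iff intro!: bexI[of _ 0])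
  then obtain t where t: "t < k" "b = (a + t) mod m"
    using assms(7) by (auto simp: arc_def)
  with \<open>a \<noteq> b\<close> assms(1) obtain t' where t': "t = Suc t'"
    by (cases t) auto
  then have "(a + t') mod m \<in> arc m b l"
    using t(1) assms(7)[symmetric] by (auto simp: arc_def)
  then obtain s where s: "s < l" "(a + t') mod m = (b + s) mod m"
    by (auto simp: arc_def)
  \<comment> \<open>If the predecessor of \<open>b\<close> is the entry \<open>b + s\<close> of the
    interval starting at \<open>b\<close>, then \<open>m\<close> divides \<open>s + 1\<close>,
    although \<open>0 < s + 1 < m\<close>.\<close>
  have "(b + Suc s) mod m = Suc ((b + s) mod m) mod m"
    by (simp add: mod_Suc_eq)
  also have "\<dots> = (a + t) mod m"
    by (simp add: s(2)[symmetric] t' mod_Suc_eq)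
  finally have "(b + Suc s) mod m = (b + 0) mod m"
    using t(2) assms(2) by simp
  then show False
    using add_mod_inj[of b "Suc s" m 0] s(1) assms by simp
qed

lemma card_arc: "k \<le> m \<Longrightarrow> card (arc m a k) = k"
  unfolding arc_def
  by (subst card_image) (auto intro!: inj_onI elim!: add_mod_inj)

text \<open>Missing elements of \<open>D\<close> are added one at a time, which never leaves the
  translate by \<open>i\<close>; its top vertex serves as a meeting point.\<close>

lemma subcube_connected:
  assumes D: "D \<subseteq> {..<d}" and i: "i < d" "i \<notin> D" and T: "T \<subseteq> D"
  shows "reach (piece (cube_adj d) {} (insert i ` Pow D)) (insert i T) (insert i D)"
    (is "reach ?A _ _")
proof -
  have "U \<subseteq> D \<Longrightarrow> reach ?A (insert i T) (insert i (T \<union> U))" if "finite U" for U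
    using that
  proof (induction U rule: finite_induct)
    case (insert x U)
    have "reach ?A (insert i (T \<union> U)) (insert i (T \<union> insert x U))"
    proof (cases "x \<in> T \<union> U")
      case True
      then have "T \<union> insert x U = T \<union> U"
        by blast
      then show ?thesis
        by simp
    next
      case False
      have "cube_adj d (insert i (T \<union> U)) (insert x (insert i (T \<union> U)))"
        using False insert.prems D i T by (intro cube_adj_insert) auto
      then have "{insert i (T \<union> U), insert x (insert i (T \<union> U))} \<in> ?A"
        using insert.prems T by (intro pieceI) (auto simp: insert_commute[of x i])
      then show ?thesis
        by (intro reach_edge) (simp add: insert_commute)
    qed
    with insert show ?case
      by (auto intro: reach_trans)
  qed simp
  moreover have "finite D"
    using D finite_subset by blast
  ultimately show ?thesis
    using T by (metis Un_absorb1 order_refl)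
qed

text \<open>Here \<open>h\<close> arranges \<open>D\<close> in a circle. Extending an interval by
  its next element is a cube edge that keeps the start fixed, and at length \<open>m\<close> the
  interval has become \<open>D\<close>.\<close>

lemma cube_fan_inside:
  assumes D: "D \<subseteq> {..<d}" and h: "bij_betw h {..<m} D" and a: "a < m" and k: "0 < k" "k \<le> m"
  shows "reach (piece (cube_adj d) {D} {h ` arc m a k | k. 0 < k \<and> k < m}) (h ` arc m a k) D"
    (is "reach ?A _ _")
  using k(2,1)
proof (induction rule: inc_induct)
  case base
  have "h ` arc m a m = D"
    using a h by (simp add: arc_full bij_betw_def)
  then show ?case
    by simp
next
  case (step l)
  let ?x = "(a + l) mod m"
  have m: "0 < m"
    using a by simp
  have x: "?x \<notin> arc m a l"
    using step.hyps add_mod_inj[of a l m] by (fastforce simp: arc_def)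
  have "h ?x \<notin> h ` arc m a l"
    using x h arc_subset[OF m, of a l] m by (subst inj_on_image_mem_iff[of h "{..<m}"]) (auto simp: bij_betw_def)
  moreover have sub: "h ` arc m a l \<subseteq> D" "h ?x \<in> D"
    using h arc_subset[OF m, of a l] m by (auto simp: bij_betw_def)
  ultimately have "cube_adj d (h ` arc m a l) (insert (h ?x) (h ` arc m a l))"
    using D by (intro cube_adj_insert) auto
  then have adj: "cube_adj d (h ` arc m a l) (h ` arc m a (Suc l))"
    by (simp add: arc_Suc)
  have "h ` arc m a (Suc l) \<in> {D} \<union> {h ` arc m a k | k. 0 < k \<and> k < m}"
  proof (cases "Suc l = m")
    case True
    then show ?thesis
      using a h by (simp add: arc_full bij_betw_def)
  next
    case False
    then show ?thesis
      using step.hyps by (intro UnI2 CollectI exI[of _ "Suc l"]) auto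
  qed
  with adj have "{h ` arc m a l, h ` arc m a (Suc l)} \<in> ?A"
    using step by (intro pieceI) auto
  then show ?case
    using step.IH by (blast intro: reach_edge reach_trans)
qed

text \<open>Two interval paths cannot meet because an interval determines its start; a set in a
  translate has exactly one element outside \<open>D\<close>, namely the index of its path.\<close>

lemma cube_fan:
  assumes D: "D \<subseteq> {..<d}"
  obtains P where
    "\<And>i. i < d \<Longrightarrow> P i \<subseteq> Pow (insert i D) - {{}, D}"
    "\<And>i. i < d \<Longrightarrow> {i} \<in> insert D (P i)"
    "\<And>i T. i < d \<Longrightarrow> T \<in> P i \<Longrightarrow> reach (piece (cube_adj d) {D} (P i)) T D"
    "\<And>i j. i < d \<Longrightarrow> j < d \<Longrightarrow> i \<noteq> j \<Longrightarrow> P i \<inter> P j = {}"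
proof -
  define m where "m = card D"
  have "finite D"
    using D finite_subset by blast
  then obtain h where h: "bij_betw h {..<m} D"
    using ex_bij_betw_nat_finite by (auto simp: m_def lessThan_atLeast0)
  define g where "g = inv_into {..<m} h"
  have g: "g i < m" "h (g i) = i" if "i \<in> D" for i
    using h that by (auto simp: g_def bij_betw_def inv_into_into f_inv_into_f
        intro: inv_into_into[of _ h "{..<m}", simplified])
  have hinj: "h ` A = h ` B \<Longrightarrow> A = B" if "A \<subseteq> {..<m}" "B \<subseteq> {..<m}" for A B
    using h that by (auto simp: bij_betw_def inj_on_image_eq_iff)
  define Q where "Q i = {h ` arc m (g i) k | k. 0 < k \<and> k < m}" for i
  define P where "P i = (if i \<in> D then Q i else insert i ` Pow D)" for i
  have arcs: "arc m a k \<subseteq> {..<m}" if "k < m" for a k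
    using that by (intro arc_subset) simp
  have cardQ: "0 < card T \<and> card T < m" "T \<subseteq> D" if "T \<in> Q i" for T i
  proof -
    obtain k where k: "T = h ` arc m (g i) k" "0 < k" "k < m"
      using \<open>T \<in> Q i\<close> by (auto simp: Q_def)
    have "inj_on h (arc m (g i) k)"
      using h arcs[OF k(3)] by (auto simp: bij_betw_def intro: inj_on_subset)
    then show "0 < card T \<and> card T < m"
      using k by (simp add: card_image card_arc)
    show "T \<subseteq> D"
      using k(1) h arcs[OF k(3), of "g i"] by (auto simp: bij_betw_def)
  qed
  show thesis
  proof (rule that)
    fix i assume "i < d"
    have "T \<notin> {{}, D}" if "T \<in> Q i" for T
      using cardQ(1)[OF that] by (auto simp: m_def)
    then show "P i \<subseteq> Pow (insert i D) - {{}, D}"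
      using cardQ(2) by (auto simp: P_def)
    \<comment> \<open>For \<open>D = {i}\<close> the path has no interior and its first vertex
      \<open>{i}\<close> is \<open>D\<close> itself.\<close>
    show "{i} \<in> insert D (P i)"
    proof (cases "i \<in> D \<and> D \<noteq> {i}")
      case True
      then have "m \<noteq> 1" "m \<noteq> 0"
        using \<open>finite D\<close> by (auto simp: m_def card_1_singleton_iff)
      moreover have "arc m (g i) 1 = {g i}"
        using g(1) True by (auto simp: arc_def)
      ultimately have "{i} \<in> Q i"
        using g True by (auto simp: Q_def intro!: exI[of _ 1])
      then show ?thesis
        using True by (simp add: P_def)
    qed (auto simp: P_def)
    show "reach (piece (cube_adj d) {D} (P i)) T D" if T: "T \<in> P i" for T
    proof (cases "i \<in> D")
      case True
      with T obtain k where "T = h ` arc m (g i) k" "0 < k" "k < m"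
        by (auto simp: P_def Q_def)
      then show ?thesis
        using cube_fan_inside[OF D h g(1)[OF True], of k] True by (simp add: P_def Q_def)
    next
      case False
      then obtain T' where T': "T = insert i T'" "T' \<subseteq> D" and P: "P i = insert i ` Pow D"
        using T by (auto simp: P_def)
      let ?A = "piece (cube_adj d) {D} (P i)"
      have "reach ?A T (insert i D)"
        unfolding T'(1) by (rule reach_mono[OF subcube_connected[OF D \<open>i < d\<close> False T'(2)]])
          (simp add: P piece_mono)
      moreover have "{insert i D, D} \<in> ?A"
        using D \<open>i < d\<close> False P by (intro pieceI cube_adj_insert') auto
      ultimately show ?thesis
        by (blast intro: reach_trans reach_edge)
    qed
    fix j assume "j < d" "i \<noteq> j"
    have "Q i \<inter> Q j = {}" if ij: "i \<in> D" "j \<in> D"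
    proof (rule ccontr)
      assume "Q i \<inter> Q j \<noteq> {}"
      then obtain k l where "h ` arc m (g i) k = h ` arc m (g j) l" "0 < k" "k < m" "0 < l" "l < m"
        by (auto simp: Q_def)
      then have "g i = g j"
        using arc_start_unique[of "g i" m "g j" k l] g(1)[OF ij(1)] g(1)[OF ij(2)] hinj[OF arcs arcs] by blast
      then show False
        using g(2)[OF ij(1)] g(2)[OF ij(2)] \<open>i \<noteq> j\<close> by simp
    qed
    then show "P i \<inter> P j = {}"
      using cardQ(2) \<open>i \<noteq> j\<close> by (auto simp: P_def)
  qed
qed

section \<open>Exit systems for one, two and three vertices\<close>

lemma exitable_pieces:
  assumes X: "X \<subseteq> Pow {..<d}"
    and W: "\<And>i. i < d \<Longrightarrow> W i \<subseteq> Pow {..<d} - X"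
    and Wd: "\<And>i j. i < d \<Longrightarrow> j < d \<Longrightarrow> i \<noteq> j \<Longrightarrow> W i \<inter> W j = {}"
    and F: "\<And>i. i < d \<Longrightarrow> F i \<subseteq> {{u, v} | u v. cube_adj d u v \<and> u \<in> X \<and> v \<in> X}"
    and Fd: "\<And>i j. i < d \<Longrightarrow> j < d \<Longrightarrow> i \<noteq> j \<Longrightarrow> F i \<inter> F j = {}"
    and E: "\<And>i. i < d \<Longrightarrow> E i \<subseteq> X \<union> W i"
    and Ed: "\<And>i j. i < d \<Longrightarrow> j < d \<Longrightarrow> i \<noteq> j \<Longrightarrow> E i \<inter> E j = {}"
    and r: "\<And>i v. i < d \<Longrightarrow> v \<in> X \<union> W i \<Longrightarrow>
      \<exists>e\<in>E i. reach (piece (cube_adj d) X (W i) \<union> F i) v e"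
  shows "exitable d X E"
  unfolding exitable_def
proof (intro exI conjI)
  show "system (cube_adj d) (Pow {..<d}) d X W (\<lambda>i. piece (cube_adj d) X (W i) \<union> F i)"
    by (rule system_pieces[OF X W Wd F Fd])
  show "exits d X W (\<lambda>i. piece (cube_adj d) X (W i) \<union> F i) E"
    using E Ed r by (simp add: exits_def)
qed

text \<open>The fan leads from \<open>D\<close> to the neighbours of the origin, which act as exits.
  By translation any vertex can play the origin, so the exits can be fitted to those in another
  cluster.\<close>

lemma exitable_one:
  assumes "D \<subseteq> {..<d}"
  shows "exitable d {D} (\<lambda>i. {{i}})"
proof -
  obtain P where P: "\<And>i. i < d \<Longrightarrow> P i \<subseteq> Pow (insert i D) - {{}, D}"
    "\<And>i. i < d \<Longrightarrow> {i} \<in> insert D (P i)"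
    "\<And>i T. i < d \<Longrightarrow> T \<in> P i \<Longrightarrow> reach (piece (cube_adj d) {D} (P i)) T D"
    "\<And>i j. i < d \<Longrightarrow> j < d \<Longrightarrow> i \<noteq> j \<Longrightarrow> P i \<inter> P j = {}"
    by (fact cube_fan[OF assms])
  have toD: "reach (piece (cube_adj d) {D} (P i)) T D" if "i < d" "T \<in> {D} \<union> P i" for i T
    using that P(3) by auto
  show ?thesis
  proof (rule exitable_pieces[where W = P and F = "\<lambda>_. {}"])
    fix i assume i: "i < d"
    show "P i \<subseteq> Pow {..<d} - {D}"
      using P(1)[OF i] i assms by fastforce
    show "\<exists>e\<in>{{i}}. reach (piece (cube_adj d) {D} (P i) \<union> {}) v e" if "v \<in> {D} \<union> P i" for v
      using toD[OF i that] toD[OF i, of "{i}"] P(2)[OF i] by (auto intro: reach_trans reach_sym)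
  qed (use assms P(2,4) in auto)
qed

lemma cube_fan_closed:
  assumes D: "D \<subseteq> {..<d}" "D \<noteq> {}"
  obtains P F where
    "\<And>i. i < d \<Longrightarrow> P i \<subseteq> Pow (insert i D) - {{}, D}"
    "\<And>i. i < d \<Longrightarrow> {i} \<in> insert D (P i)"
    "\<And>i j. i < d \<Longrightarrow> j < d \<Longrightarrow> i \<noteq> j \<Longrightarrow> P i \<inter> P j = {}"
    "\<And>i. i < d \<Longrightarrow> F i \<subseteq> {{u, v} | u v. cube_adj d u v \<and> u \<in> {{}, D} \<and> v \<in> {{}, D}}"
    "\<And>i j. i < d \<Longrightarrow> j < d \<Longrightarrow> i \<noteq> j \<Longrightarrow> F i \<inter> F j = {}"
    "\<And>i X W T. i < d \<Longrightarrow> {{}, D} \<subseteq> X \<Longrightarrow> P i \<subseteq> W \<Longrightarrow> T \<in> {{}, D} \<union> P i \<Longrightarrow>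
      reach (piece (cube_adj d) X W \<union> F i) {i} T"
proof -
  obtain P where P: "\<And>i. i < d \<Longrightarrow> P i \<subseteq> Pow (insert i D) - {{}, D}"
    "\<And>i. i < d \<Longrightarrow> {i} \<in> insert D (P i)"
    "\<And>i T. i < d \<Longrightarrow> T \<in> P i \<Longrightarrow> reach (piece (cube_adj d) {D} (P i)) T D"
    "\<And>i j. i < d \<Longrightarrow> j < d \<Longrightarrow> i \<noteq> j \<Longrightarrow> P i \<inter> P j = {}"
    by (fact cube_fan[OF D(1)])
  define F where "F i = (if {i} = D then {{{i}, {}}} else {})" for i
  show thesis
  proof (rule that[OF P(1,2,4)])
    fix i assume i: "i < d"
    have adj: "cube_adj d {i} {}"
      using cube_adj_insert'[OF i, of "{}"] by simp
    then show "F i \<subseteq> {{u, v} | u v. cube_adj d u v \<and> u \<in> {{}, D} \<and> v \<in> {{}, D}}"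
      by (auto simp: F_def)
    show "F i \<inter> F j = {}" if "i \<noteq> j" for j
      using that by (auto simp: F_def)
    fix X W T assume XW: "{{}, D} \<subseteq> X" "P i \<subseteq> W" "T \<in> {{}, D} \<union> P i"
    let ?A = "piece (cube_adj d) X W \<union> F i"
    have sub: "piece (cube_adj d) {D} (P i) \<subseteq> ?A"
      using piece_mono[of "{D}" X "P i" W "cube_adj d"] XW by blast
    have toD: "reach ?A T D" if "T \<in> insert D (P i)" for T
      using that reach_mono[OF P(3)[OF i] sub] by auto
    have "{{i}, {}} \<in> ?A"
    proof (cases "{i} = D")
      case False
      then have "{i} \<in> W"
        using P(2)[OF i] XW by blast
      then show ?thesis
        using XW(1) by (intro UnI1 pieceI adj) auto
    qed (simp add: F_def)
    then have "reach ?A {i} {}"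
      by (rule reach_edge)
    moreover have "reach ?A {i} T" if "T \<in> insert D (P i)" for T
      using toD[OF that] toD[OF P(2)[OF i]] by (blast intro: reach_sym reach_trans)
    ultimately show "reach ?A {i} T"
      using XW(3) by blast
  qed
qed

text \<open>The parameter \<open>a\<close> is a vertex to be avoided: the only piece, if any, that
  would leave through \<open>a\<close> leaves through \<open>{}\<close> instead.\<close>

lemma exitable_two:
  assumes "D \<subseteq> {..<d}" "D \<noteq> {}"
  shows "exitable d {{}, D} (\<lambda>i. if {i} = a then {{}} else {{i}})"
proof -
  obtain P F where P: "\<And>i. i < d \<Longrightarrow> P i \<subseteq> Pow (insert i D) - {{}, D}"
    "\<And>i. i < d \<Longrightarrow> {i} \<in> insert D (P i)"
    "\<And>i j. i < d \<Longrightarrow> j < d \<Longrightarrow> i \<noteq> j \<Longrightarrow> P i \<inter> P j = {}"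
    and F: "\<And>i. i < d \<Longrightarrow> F i \<subseteq> {{u, v} | u v. cube_adj d u v \<and> u \<in> {{}, D} \<and> v \<in> {{}, D}}"
    "\<And>i j. i < d \<Longrightarrow> j < d \<Longrightarrow> i \<noteq> j \<Longrightarrow> F i \<inter> F j = {}"
    and r: "\<And>i X W T. i < d \<Longrightarrow> {{}, D} \<subseteq> X \<Longrightarrow> P i \<subseteq> W \<Longrightarrow> T \<in> {{}, D} \<union> P i \<Longrightarrow>
      reach (piece (cube_adj d) X W \<union> F i) {i} T"
    by (fact cube_fan_closed[OF assms])
  show ?thesis
  proof (rule exitable_pieces[where W = P and F = F])
    fix i assume i: "i < d"
    show "P i \<subseteq> Pow {..<d} - {{}, D}"
      using P(1)[OF i] i assms by fastforce
    show "\<exists>e\<in>if {i} = a then {{}} else {{i}}. reach (piece (cube_adj d) {{}, D} (P i) \<union> F i) v e"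
      if "v \<in> {{}, D} \<union> P i" for v
      using r[OF i order_refl order_refl that] r[OF i order_refl order_refl, of "{}"]
      by (auto intro: reach_trans reach_sym)
    show "(if {i} = a then {{}} else {{i}}) \<subseteq> {{}, D} \<union> P i"
      using P(2)[OF i] by auto
    show "(if {i} = a then {{}} else {{i}}) \<inter> (if {j} = a then {{}} else {{j}}) = {}"
      if "i \<noteq> j" for j
      using that by auto
  qed (use assms P(3) F in auto)
qed

text \<open>Piece \<open>i\<close> consists of the \<open>i\<close>-th fan path between
  \<open>{}\<close> and \<open>D\<close> and of a neighbour of \<open>z\<close>, each with its own
  exit. A neighbour of \<open>z\<close> containing both \<open>k\<close> and \<open>k'\<close> lies
  on no fan path, while \<open>z - {k}\<close> can lie only on path \<open>k'\<close> and
  \<open>z - {k'}\<close> only on path \<open>k\<close>; hence the swap \<open>\<pi>\<close>. Exits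
  equal to \<open>a\<close> are replaced by \<open>{}\<close> or \<open>z\<close>.\<close>

lemma exitable_three:
  assumes D: "D \<subseteq> {..<d}" "D \<noteq> {}" and z: "z \<subseteq> {..<d}"
    and k: "k \<in> z" "k' \<in> z" "k \<noteq> k'" "k \<notin> D" "k' \<notin> D"
  defines "\<pi> \<equiv> (\<lambda>i. if i = k then k' else if i = k' then k else i)"
  shows "exitable d {{}, D, z} (\<lambda>i. {if {i} = a then {} else {i},
      if flip (\<pi> i) z = a then z else flip (\<pi> i) z})"
proof -
  obtain P F where P: "\<And>i. i < d \<Longrightarrow> P i \<subseteq> Pow (insert i D) - {{}, D}"
    "\<And>i. i < d \<Longrightarrow> {i} \<in> insert D (P i)"
    "\<And>i j. i < d \<Longrightarrow> j < d \<Longrightarrow> i \<noteq> j \<Longrightarrow> P i \<inter> P j = {}"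
    and F: "\<And>i. i < d \<Longrightarrow> F i \<subseteq> {{u, v} | u v. cube_adj d u v \<and> u \<in> {{}, D} \<and> v \<in> {{}, D}}"
    "\<And>i j. i < d \<Longrightarrow> j < d \<Longrightarrow> i \<noteq> j \<Longrightarrow> F i \<inter> F j = {}"
    and r: "\<And>i X W T. i < d \<Longrightarrow> {{}, D} \<subseteq> X \<Longrightarrow> P i \<subseteq> W \<Longrightarrow> T \<in> {{}, D} \<union> P i \<Longrightarrow>
      reach (piece (cube_adj d) X W \<union> F i) {i} T"
    by (fact cube_fan_closed[OF D])
  let ?X = "{{}, D, z}"
  define W where "W i = insert (flip (\<pi> i) z) (P i)" for i
  have kd: "k < d" "k' < d"
    using k(1,2) z by auto
  have \<pi>d: "\<pi> i < d" if "i < d" for i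
    using kd that by (simp add: \<pi>_def)
  have \<pi>inj: "\<pi> i = \<pi> j \<longleftrightarrow> i = j" for i j
    using k(3) by (auto simp: \<pi>_def)
  have Z: "i = j" if "flip (\<pi> i) z \<subseteq> insert j D" for i j
    using that k by (auto simp: \<pi>_def flip_def split: if_splits)
  have zP: "z \<notin> P i" if "i < d" for i
    using P(1)[OF that] k by blast
  \<comment> \<open>A subset of \<open>D\<close> would by \<open>Z\<close> force both
    \<open>i = k\<close> and \<open>i = k'\<close>.\<close>
  have ZX: "flip (\<pi> i) z \<notin> ?X" for i
    using Z[of i k] Z[of i k'] k(3) by auto
  have zX: "z \<noteq> {}" "z \<noteq> D" "{i} \<noteq> z" for i
    using k by auto
  have Wsub: "flip (\<pi> i) z \<subseteq> {..<d}" if "i < d" for i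
    using that \<pi>d z by (simp add: flip_subset)
  have E1: "{i} \<noteq> flip (\<pi> j) z" "flip (\<pi> j) z \<noteq> {i}" if "i \<noteq> j" for i j
    using Z[of j i] that by auto
  \<comment> \<open>At most one piece has \<open>a\<close> as its fan exit and at most one as its
    neighbour of \<open>z\<close>, and the substitutes \<open>{}\<close> and \<open>z\<close> are
    not among the original exits.\<close>
  have disj: "{if p = a then {} else p, if f = a then z else f} \<inter>
      {if q = a then {} else q, if g = a then z else g} = {}"
    if "f \<noteq> g" "p \<noteq> q" "p \<noteq> g" "q \<noteq> f" "p \<noteq> {}" "q \<noteq> {}" "f \<noteq> {}" "g \<noteq> {}"
      "p \<noteq> z" "q \<noteq> z" "f \<noteq> z" "g \<noteq> z" "z \<noteq> {}" for p q f g :: "nat set"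
    using that by (simp split: if_split) metis
  show ?thesis
  proof (rule exitable_pieces[where W = W and F = F])
    fix i assume i: "i < d"
    show "W i \<subseteq> Pow {..<d} - ?X"
      using P(1)[OF i] i D zP[OF i] ZX[of i] Wsub[OF i] by (fastforce simp: W_def)
    show "W i \<inter> W j = {}" if j: "j < d" "i \<noteq> j" for j
    proof -
      have "flip (\<pi> i) z \<notin> P j" "flip (\<pi> j) z \<notin> P i"
        using P(1)[OF i] P(1)[OF j(1)] Z[of i j] Z[of j i] j(2) by blast+
      then show ?thesis
        using P(3)[OF i j] j(2) by (simp add: W_def flip_inj \<pi>inj)
    qed
    show "F i \<subseteq> {{u, v} | u v. cube_adj d u v \<and> u \<in> ?X \<and> v \<in> ?X}"
      using F(1)[OF i] by blast
    let ?A = "piece (cube_adj d) ?X (W i) \<union> F i"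
    let ?E = "\<lambda>i. {if {i} = a then {} else {i}, if flip (\<pi> i) z = a then z else flip (\<pi> i) z}"
    show "?E i \<subseteq> ?X \<union> W i"
      using P(2)[OF i] by (auto simp: W_def)
    show "?E i \<inter> ?E j = {}" if "i \<noteq> j" for j
    proof (rule disj)
      show "flip (\<pi> i) z \<noteq> flip (\<pi> j) z"
        using that by (simp add: flip_inj \<pi>inj)
    qed (use that E1[of i j] E1[of j i] zX ZX[of i] ZX[of j] in simp_all)
    have rP: "reach ?A {i} T" if "T \<in> {{}, D} \<union> P i" for T
      using that i by (intro r) (auto simp: W_def)
    have rz: "reach ?A (flip (\<pi> i) z) z"
    proof (intro reach_edge UnI1 pieceI)
      show "cube_adj d (flip (\<pi> i) z) z"
        using Wsub[OF i] \<pi>d[OF i] unfolding cube_adj_def by (metis flip_flip)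
    qed (auto simp: W_def)
    show "\<exists>e\<in>?E i. reach ?A v e" if v: "v \<in> ?X \<union> W i" for v
    proof (cases "v \<in> {{}, D} \<union> P i")
      case True
      then have "reach ?A v (if {i} = a then {} else {i})"
        using rP[OF True] rP[of "{}"] by (auto intro: reach_trans reach_sym)
      then show ?thesis
        by blast
    next
      case False
      then have "v = z \<or> v = flip (\<pi> i) z"
        using v by (auto simp: W_def)
      then have "reach ?A v (if flip (\<pi> i) z = a then z else flip (\<pi> i) z)"
        using rz reach_sym[OF rz] by auto
      then show ?thesis
        by blast
    qed
  qed (use D z F in auto)
qed

text \<open>Directions outside \<open>C\<close> come for free: for such \<open>i\<close> the
  translate of the whole subcube by \<open>i\<close> is connected, contains a neighbour of each
  vertex of \<open>X\<close>, and may be left at any of its vertices. Only the small subcube needs a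
  system made by hand.\<close>

lemma exitable_from_subcube:
  assumes C: "C \<subseteq> {..<d}" and X: "X \<subseteq> Pow C"
    and W: "\<And>i. i \<in> C \<Longrightarrow> W i \<subseteq> Pow C - X"
    and Wd: "\<And>i j. i \<in> C \<Longrightarrow> j \<in> C \<Longrightarrow> i \<noteq> j \<Longrightarrow> W i \<inter> W j = {}"
    and F: "\<And>i. i \<in> C \<Longrightarrow> F i \<subseteq> {{u, v} | u v. cube_adj d u v \<and> u \<in> X \<and> v \<in> X}"
    and Fd: "\<And>i j. i \<in> C \<Longrightarrow> j \<in> C \<Longrightarrow> i \<noteq> j \<Longrightarrow> F i \<inter> F j = {}"
    and E: "\<And>i. i \<in> C \<Longrightarrow> E i \<subseteq> X \<union> W i"
    and Ed: "\<And>i j. i \<in> C \<Longrightarrow> j \<in> C \<Longrightarrow> i \<noteq> j \<Longrightarrow> E i \<inter> E j = {}"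
    and r: "\<And>i v. i \<in> C \<Longrightarrow> v \<in> X \<union> W i \<Longrightarrow>
      \<exists>e\<in>E i. reach (piece (cube_adj d) X (W i) \<union> F i) v e"
    and Y: "\<And>i. Y i \<subseteq> C"
  shows "exitable d X (\<lambda>i. if i \<in> C then E i else {insert i (Y i)})"
proof (rule exitable_pieces[where W = "\<lambda>i. if i \<in> C then W i else insert i ` Pow C"
      and F = "\<lambda>i. if i \<in> C then F i else {}"])
  let ?W = "\<lambda>i. if i \<in> C then W i else insert i ` Pow C"
  let ?F = "\<lambda>i. if i \<in> C then F i else {}"
  let ?E = "\<lambda>i. if i \<in> C then E i else {insert i (Y i)}"
  show "X \<subseteq> Pow {..<d}"
    using C X by blast
  fix i assume i: "i < d"
  show "?W i \<subseteq> Pow {..<d} - X"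
  proof (cases "i \<in> C")
    case True
    then show ?thesis
      using W[OF True] C by (simp, blast)
  next
    case False
    then show ?thesis
      using X C i by (simp, blast)
  qed
  show "?F i \<subseteq> {{u, v} | u v. cube_adj d u v \<and> u \<in> X \<and> v \<in> X}"
    using F[of i] by simp
  have EC: "E j \<subseteq> Pow C" if "j \<in> C" for j
    using E[OF that] W[OF that] X by blast
  show "?E i \<subseteq> X \<union> ?W i"
    using E[of i] Y[of i] by simp
  {
    fix j assume ij: "i \<noteq> j"
    show "?W i \<inter> ?W j = {}"
      using Wd[OF _ _ ij] W[of i] W[of j] ij by (cases "i \<in> C"; cases "j \<in> C") auto
    show "?F i \<inter> ?F j = {}"
      using Fd[OF _ _ ij] by simp
    show "?E i \<inter> ?E j = {}"
      using Ed[OF _ _ ij] EC[of i] EC[of j] Y[of i] Y[of j] ij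
      by (cases "i \<in> C"; cases "j \<in> C") auto
  }
  fix v assume v: "v \<in> X \<union> ?W i"
  show "\<exists>e\<in>?E i. reach (piece (cube_adj d) X (?W i) \<union> ?F i) v e"
  proof (cases "i \<in> C")
    case True
    then show ?thesis
      using r[OF True] v by simp
  next
    case False
    let ?A = "piece (cube_adj d) X (insert i ` Pow C)"
    have top: "reach ?A (insert i T) (insert i C)" if "T \<subseteq> C" for T
      by (rule reach_mono[OF subcube_connected[OF C i False that]]) (simp add: piece_mono)
    have "\<exists>T\<subseteq>C. reach ?A v (insert i T)"
    proof (cases "v \<in> X")
      case True
      then have "v \<subseteq> C"
        using X by blast
      moreover have "{insert i v, v} \<in> ?A"
        using True \<open>v \<subseteq> C\<close> C i False by (intro pieceI cube_adj_insert') auto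
      ultimately show ?thesis
        by (blast intro: reach_sym reach_edge)
    next
      case False
      then show ?thesis
        using v \<open>i \<notin> C\<close> by auto
    qed
    then obtain T where "T \<subseteq> C" "reach ?A v (insert i T)"
      by blast
    then have "reach ?A v (insert i (Y i))"
      using top[of T] reach_sym[OF top[OF Y]] by (blast intro: reach_trans)
    then show ?thesis
      using False by simp
  qed
qed

section \<open>Three vertices close together\<close>

lemma reach_piece:
  "cube_adj d u v \<Longrightarrow> u \<in> W \<Longrightarrow> v \<in> X \<union> W \<Longrightarrow> reach (piece (cube_adj d) X W \<union> F) u v"
  by (rule reach_edge, rule UnI1, rule pieceI)

text \<open>In the square, piece \<open>p\<close> is the path through \<open>{}\<close> formed by
  the edges inside \<open>X\<close>. Piece \<open>q\<close> joins \<open>{p}\<close> and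
  \<open>{q}\<close> through \<open>{p, q}\<close> and isolates \<open>{}\<close>, which is
  therefore its own exit.\<close>

lemma exitable_corner:
  assumes pq: "p < d" "q < d" "p \<noteq> q"
    and e: "e \<in> {{p}, {q}}" "e' \<in> {{p}, {q}, {p, q}}" "e \<noteq> e'" and Y: "\<And>i. Y i \<subseteq> {p, q}"
  shows "exitable d {{}, {p}, {q}}
    (\<lambda>i. if i \<in> {p, q} then if i = p then {e} else {{}, e'} else {insert i (Y i)})"
proof (rule exitable_from_subcube[where W = "\<lambda>i. if i = p then {} else {{p, q}}"
      and F = "\<lambda>i. if i = p then {{{}, {p}}, {{}, {q}}} else {}"])
  let ?X = "{{}, {p}, {q}}"
  have adj: "cube_adj d {} {p}" "cube_adj d {} {q}" "cube_adj d {p, q} {p}" "cube_adj d {p, q} {q}"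
    using cube_adj_insert[of p d "{}"] cube_adj_insert[of q d "{}"] cube_adj_insert'[of q d "{p}"]
      cube_adj_insert'[of p d "{q}"] pq by (auto simp: insert_commute)
  fix i v assume i: "i \<in> {p, q}"
  show "(if i = p then {{{}, {p}}, {{}, {q}}} else {})
      \<subseteq> {{u, v} | u v. cube_adj d u v \<and> u \<in> ?X \<and> v \<in> ?X}"
    using adj(1,2) by simp blast
  assume v: "v \<in> ?X \<union> (if i = p then {} else {{p, q}})"
  show "\<exists>e\<in>(if i = p then {e} else {{}, e'}). reach (piece (cube_adj d) ?X
      (if i = p then {} else {{p, q}}) \<union> (if i = p then {{{}, {p}}, {{}, {q}}} else {})) v e"
  proof (cases "i = p")
    case True
    let ?A = "piece (cube_adj d) ?X {} \<union> {{{}, {p}}, {{}, {q}}}"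
    have "reach ?A {} {p}" "reach ?A {} {q}"
      by (rule reach_edge, simp)+
    then have "reach ?A {} u" if "u \<in> ?X" for u
      using that by blast
    from reach_trans[OF reach_sym[OF this] this] show ?thesis
      using v e(1) True by auto
  next
    case False
    let ?A = "piece (cube_adj d) ?X {{p, q}} \<union> {}"
    have "reach ?A {p, q} {p}" "reach ?A {p, q} {q}"
      by (rule reach_piece[OF adj(3)] reach_piece[OF adj(4)], simp, simp)+
    then have star: "reach ?A {p, q} u" if "u \<in> {{p}, {q}, {p, q}}" for u
      using that by blast
    show ?thesis
    proof (cases "v = {}")
      case True
      then show ?thesis
        using \<open>i \<noteq> p\<close> by (auto intro!: bexI[of _ "{}"])
    next
      case False
      then have "reach ?A v e'"
        using v \<open>i \<noteq> p\<close> by (intro reach_trans[OF reach_sym[OF star] star] e(2)) auto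
      then show ?thesis
        using \<open>i \<noteq> p\<close> by simp
    qed
  qed
qed (use pq e Y in auto)

text \<open>Variant in which \<open>{}\<close> is no exit. Piece \<open>p\<close> consists of
  \<open>{}\<close> attached to \<open>{p}\<close> together with the path over
  \<open>{p, q}\<close>; piece \<open>q\<close> has only the edge from \<open>{}\<close> to
  \<open>{q}\<close>, with \<open>{p}\<close> isolated and its own exit.\<close>

lemma exitable_corner':
  assumes pq: "p < d" "q < d" "p \<noteq> q"
  shows "exitable d {{}, {p}, {q}}
    (\<lambda>i. if i \<in> {p, q} then if i = p then {{p, q}} else {{p}, {q}} else {{i}})"
proof (rule exitable_from_subcube[where W = "\<lambda>i. if i = p then {{p, q}} else {}"
      and F = "\<lambda>i. {{{}, {i}}}" and Y = "\<lambda>_. {}"])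
  let ?X = "{{}, {p}, {q}}"
  have adj: "cube_adj d {} {p}" "cube_adj d {} {q}" "cube_adj d {p, q} {p}" "cube_adj d {p, q} {q}"
    using cube_adj_insert[of p d "{}"] cube_adj_insert[of q d "{}"] cube_adj_insert'[of q d "{p}"]
      cube_adj_insert'[of p d "{q}"] pq by (auto simp: insert_commute)
  fix i v assume i: "i \<in> {p, q}"
  show "{{{}, {i}}} \<subseteq> {{u, v} | u v. cube_adj d u v \<and> u \<in> ?X \<and> v \<in> ?X}"
    using adj(1,2) i by simp blast
  assume v: "v \<in> ?X \<union> (if i = p then {{p, q}} else {})"
  show "\<exists>e\<in>(if i = p then {{p, q}} else {{p}, {q}}). reach (piece (cube_adj d) ?X
      (if i = p then {{p, q}} else {}) \<union> {{{}, {i}}}) v e"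
  proof (cases "i = p")
    case True
    let ?A = "piece (cube_adj d) ?X {{p, q}} \<union> {{{}, {p}}}"
    have star: "reach ?A {p, q} {p}" "reach ?A {p, q} {q}"
      by (rule reach_piece[OF adj(3)] reach_piece[OF adj(4)], simp, simp)+
    have "reach ?A {p} {}"
      by (rule reach_sym[OF reach_edge]) simp
    with star(1) have "reach ?A {p, q} {}"
      by (rule reach_trans)
    with star have "reach ?A {p, q} v"
      using v True by auto
    then show ?thesis
      using True by (simp add: reach_sym)
  next
    case False
    then have "i = q"
      using i by simp
    have "reach (piece (cube_adj d) ?X {} \<union> {{{}, {q}}}) {} {q}"
      by (rule reach_edge) simp
    then show ?thesis
      using v False \<open>i = q\<close> by auto
  qed
qed (use pq in \<open>auto simp: doubleton_eq_iff\<close>)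

text \<open>Three pieces in the 3-cube: the star with centre \<open>{}\<close>; the path from
  \<open>{p}\<close> over \<open>{p, r}\<close> to \<open>{r}\<close>, with \<open>{q}\<close>
  isolated and its own exit; and the path \<open>{p}\<close>, \<open>{p, q}\<close>,
  \<open>{q}\<close>, \<open>{q, r}\<close>, \<open>{r}\<close>.\<close>

lemma exitable_tripod:
  assumes pqr: "p < d" "q < d" "r < d" "p \<noteq> q" "p \<noteq> r" "q \<noteq> r"
    and e: "e\<^sub>p \<in> {{p}, {}}" "e\<^sub>q \<in> {{p, r}, {p}}" "e\<^sub>r \<in> {{r}, {p, q}}" "e\<^sub>p \<noteq> e\<^sub>q"
    and Y: "\<And>i. Y i \<subseteq> {p, q, r}"
  shows "exitable d {{p}, {q}, {r}}
    (\<lambda>i. if i \<in> {p, q, r} then if i = p then {e\<^sub>p} else if i = q then {{q}, e\<^sub>q} else {e\<^sub>r}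
      else {insert i (Y i)})"
proof (rule exitable_from_subcube[where F = "\<lambda>_. {}" and
      W = "\<lambda>i. if i = p then {{}} else if i = q then {{p, r}} else {{p, q}, {q, r}}"])
  let ?X = "{{p}, {q}, {r}}"
  have adj1: "cube_adj d {} {s}" if "s < d" for s
    using cube_adj_insert[OF that, of "{}"] by simp
  have adj2: "cube_adj d {s, t} {t}" if "s < d" "t < d" "s \<noteq> t" for s t
    using cube_adj_insert'[OF that(1), of "{t}"] that by simp
  have adj2': "cube_adj d {t, s} {t}" if "s < d" "t < d" "s \<noteq> t" for s t
    using adj2[OF that] by (simp add: insert_commute)
  have e_ne: "e\<^sub>p \<noteq> {q}" "e\<^sub>q \<noteq> e\<^sub>p" "e\<^sub>r \<noteq> e\<^sub>p" "e\<^sub>r \<noteq> {q}" "e\<^sub>q \<noteq> e\<^sub>r"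
    using e pqr by (auto simp: doubleton_eq_iff)
  fix i j v assume i: "i \<in> {p, q, r}"
  let ?W = "\<lambda>i. if i = p then {{}} else if i = q then {{p, r}} else {{p, q}, {q, r}}"
  let ?E = "\<lambda>i. if i = p then {e\<^sub>p} else if i = q then {{q}, e\<^sub>q} else {e\<^sub>r}"
  show "?W i \<subseteq> Pow {p, q, r} - ?X"
    using pqr by (auto simp: doubleton_eq_iff)
  show "?E i \<subseteq> ?X \<union> ?W i"
    using i e by auto
  {
    assume "j \<in> {p, q, r}" "i \<noteq> j"
    then show "?W i \<inter> ?W j = {}" "?E i \<inter> ?E j = {}"
      using i pqr e_ne by (auto simp: doubleton_eq_iff)
  }
  assume v: "v \<in> ?X \<union> ?W i"
  consider "i = p" | "i = q" | "i = r"
    using i by blast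
  then show "\<exists>e\<in>?E i. reach (piece (cube_adj d) ?X (?W i) \<union> {}) v e"
  proof cases
    case 1
    let ?A = "piece (cube_adj d) ?X {{}} \<union> {}"
    have "reach ?A {} {s}" if "s \<in> {p, q, r}" for s
      using that pqr by (intro reach_piece adj1) auto
    then have star: "reach ?A {} u" if "u \<in> ?X \<union> {{}}" for u
      using that by auto
    have "reach ?A v e\<^sub>p"
      using v e(1) 1 by (intro reach_trans[OF reach_sym[OF star] star]) auto
    then show ?thesis
      using 1 by simp
  next
    case 2
    let ?A = "piece (cube_adj d) ?X {{p, r}} \<union> {}"
    have "reach ?A {p, r} {p}"
      by (rule reach_piece[OF adj2']) (use pqr in simp_all)
    moreover have "reach ?A {p, r} {r}"
      by (rule reach_piece[OF adj2]) (use pqr in simp_all)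
    ultimately have star: "reach ?A {p, r} u" if "u \<in> {{p}, {r}, {p, r}}" for u
      using that by auto
    show ?thesis
    proof (cases "v = {q}")
      case True
      then show ?thesis
        using 2 pqr by auto
    next
      case False
      then have "reach ?A v e\<^sub>q"
        using v e(2) 2 pqr by (intro reach_trans[OF reach_sym[OF star] star]) auto
      then show ?thesis
        using 2 pqr by simp
    qed
  next
    case 3
    let ?A = "piece (cube_adj d) ?X {{p, q}, {q, r}} \<union> {}"
    have h1: "reach ?A {p, q} {p}"
      by (rule reach_piece[OF adj2']) (use pqr in simp_all)
    have h2: "reach ?A {q, r} {q}"
      by (rule reach_piece[OF adj2']) (use pqr in simp_all)
    have h3: "reach ?A {p, q} {q}"
      by (rule reach_piece[OF adj2]) (use pqr in simp_all)
    have h4: "reach ?A {q, r} {r}"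
      by (rule reach_piece[OF adj2]) (use pqr in simp_all)
    note q = reach_sym[OF h3] reach_sym[OF h2]
    note q reach_trans[OF q(1) h1] reach_trans[OF q(2) h4]
    then have star: "reach ?A {q} u" if "u \<in> {{p}, {q}, {r}, {p, q}, {q, r}}" for u
      using that by auto
    have "reach ?A v e\<^sub>r"
      using v e(3) 3 pqr by (intro reach_trans[OF reach_sym[OF star] star]) auto
    then show ?thesis
      using 3 pqr by simp
  qed
qed (use pqr Y in auto)

section \<open>Exit systems for arbitrary sets of three vertices\<close>

text \<open>The first property serves the case of two clusters of the same class, the second that of
  different classes.\<close>

definition versatile :: "nat \<Rightarrow> nat set set \<Rightarrow> bool" where
  "versatile d X \<longleftrightarrow>
     (\<exists>u E. u \<subseteq> {..<d} \<and> exitable d X E \<and> (\<forall>i<d. flip i u \<in> E i)) \<and>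
     (\<forall>a. \<exists>E. exitable d X E \<and> (\<forall>i<d. a \<notin> E i))"

lemma versatile_translate:
  assumes "versatile d X" "t \<subseteq> {..<d}"
  shows "versatile d (sym_diff t ` X)"
  unfolding versatile_def
proof (intro conjI allI)
  obtain u E where "u \<subseteq> {..<d}" "exitable d X E" "\<forall>i<d. flip i u \<in> E i"
    using assms(1) by (auto simp: versatile_def)
  then show "\<exists>u E. u \<subseteq> {..<d} \<and> exitable d (sym_diff t ` X) E \<and> (\<forall>i<d. flip i u \<in> E i)"
    using assms(2) exitable_translate[of d X E t]
    by (intro exI[of _ "sym_diff t u"] exI[of _ "\<lambda>i. sym_diff t ` E i"]) (auto simp: flip_sym_diff)
next
  fix a
  obtain E where E: "exitable d X E" "\<forall>i<d. sym_diff t a \<notin> E i"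
    using assms(1) unfolding versatile_def by blast
  have "a \<notin> sym_diff t ` E i" if "i < d" for i
  proof
    assume "a \<in> sym_diff t ` E i"
    then obtain b where "a = sym_diff t b" "b \<in> E i"
      by blast
    then show False
      using E(2) that sym_diff_cancel[of t b] by metis
  qed
  with exitable_translate[OF E(1) assms(2)]
  show "\<exists>E. exitable d (sym_diff t ` X) E \<and> (\<forall>i<d. a \<notin> E i)"
    by blast
qed

lemma versatile_far:
  assumes D: "D \<subseteq> {..<d}" "D \<noteq> {}" and z: "z \<subseteq> {..<d}"
    and k: "k \<in> z" "k' \<in> z" "k \<noteq> k'" "k \<notin> D" "k' \<notin> D"
  shows "versatile d {{}, D, z}"
  unfolding versatile_def
proof (intro conjI allI)
  note ex = exitable_three[OF assms]
  \<comment> \<open>For \<open>a = {}\<close> no exit \<open>{i}\<close> is replaced, and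
    \<open>{i}\<close> is the flip of \<open>u = {}\<close>.\<close>
  show "\<exists>u E. u \<subseteq> {..<d} \<and> exitable d {{}, D, z} E \<and> (\<forall>i<d. flip i u \<in> E i)"
    by (rule exI[of _ "{}"], rule exI, intro conjI, simp, rule ex[of "{}"]) auto
  fix a
  have avoid: "a \<notin> {if {i} = a then {} else {i}, if f = a then z else f}" if "f \<noteq> z" for f i
    using that by (cases "{i} = a"; cases "f = a") auto
  show "\<exists>E. exitable d {{}, D, z} E \<and> (\<forall>i<d. a \<notin> E i)"
    by (rule exI, rule conjI, rule ex[of a], intro allI impI, rule avoid, simp)
qed

lemma versatile_corner:
  assumes pq: "p < d" "q < d" "p \<noteq> q"
  shows "versatile d {{}, {p}, {q}}"
  unfolding versatile_def
proof (intro conjI allI)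
  note ex = exitable_corner[OF assms]
  show "\<exists>u E. u \<subseteq> {..<d} \<and> exitable d {{}, {p}, {q}} E \<and> (\<forall>i<d. flip i u \<in> E i)"
    by (rule exI[of _ "{}"], rule exI, intro conjI, simp, rule ex[of "{p}" "{q}" "\<lambda>_. {}"])
      (use pq in auto)
  fix a
  show "\<exists>E. exitable d {{}, {p}, {q}} E \<and> (\<forall>i<d. a \<notin> E i)"
  \<comment> \<open>The first corner system always exits at \<open>{}\<close>, so avoiding
    \<open>{}\<close> takes the second one. Any other \<open>a\<close> is dodged by the choice of
    \<open>e\<close> and \<open>e'\<close> and, for directions outside \<open>{p, q}\<close>, by
    moving the exit from \<open>{i}\<close> to \<open>{i, p}\<close>.\<close>
  proof (cases "a = {}")
    case True
    show ?thesis
      by (rule exI, rule conjI, rule exitable_corner'[OF pq]) (use True in auto)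
  next
    case False
    show ?thesis
    proof (rule exI, rule conjI, rule ex[of "if a = {p} then {q} else {p}"
          "if a \<in> {{p}, {q}} then {p, q} else {q}" "\<lambda>i. if a = {i} then {p} else {}"])
    qed (use pq False in \<open>auto simp: doubleton_eq_iff\<close>)
  qed
qed

lemma versatile_tripod:
  assumes pqr: "p < d" "q < d" "r < d" "p \<noteq> q" "p \<noteq> r" "q \<noteq> r"
  shows "versatile d {{p}, {q}, {r}}"
  unfolding versatile_def
proof (intro conjI allI)
  note ex = exitable_tripod[OF assms]
  show "\<exists>u E. u \<subseteq> {..<d} \<and> exitable d {{p}, {q}, {r}} E \<and> (\<forall>i<d. flip i u \<in> E i)"
    by (rule exI[of _ "{}"], rule exI, intro conjI, simp,
        rule ex[of "{p}" "{p, r}" "{r}" "\<lambda>_. {}"])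
      (use pqr in auto)
  have avoid: "\<exists>E. exitable d {{p}, {q}, {r}} E \<and> (\<forall>i<d. a \<notin> E i)"
    if pqr: "p < d" "q < d" "r < d" "p \<noteq> q" "p \<noteq> r" "q \<noteq> r" and a: "a \<noteq> {q}" for p q r a
  \<comment> \<open>For \<open>a = {p, r}\<close> the second piece moves to \<open>{p}\<close>; the
    first piece then uses \<open>{}\<close> to keep the two apart.\<close>
  proof (rule exI, rule conjI, rule exitable_tripod[OF pqr, of
        "if a \<in> {{p}, {p, r}} then {} else {p}" "if a = {p, r} then {p} else {p, r}"
        "if a = {r} then {p, q} else {r}" "\<lambda>i. if a = {i} then {p} else {}"])
  qed (use pqr a in \<open>auto simp: doubleton_eq_iff\<close>)
  fix a
  show "\<exists>E. exitable d {{p}, {q}, {r}} E \<and> (\<forall>i<d. a \<notin> E i)"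
  \<comment> \<open>Every tripod system has the exit \<open>{q}\<close>; exchanging \<open>p\<close>
    and \<open>q\<close> turns this forced exit into \<open>{p}\<close>.\<close>
  proof (cases "a = {q}")
    case True
    then show ?thesis
      using avoid[of q p r a] pqr by (auto simp: insert_commute)
  next
    case False
    then show ?thesis
      using avoid[of p q r a] pqr by auto
  qed
qed

text \<open>Either one set has two elements, which then lie outside the other two sets, or all sets
  have at most one element. The latter is a corner if one set is empty and a tripod
  otherwise.\<close>

lemma versatile_disjoint:
  assumes sub: "x \<subseteq> {..<d}" "y \<subseteq> {..<d}" "z \<subseteq> {..<d}"
    and distinct: "x \<noteq> y" "x \<noteq> z" "y \<noteq> z"
    and disjoint: "x \<inter> y = {}" "x \<inter> z = {}" "y \<inter> z = {}"
  shows "versatile d {x, y, z}"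
proof -
  have far: "versatile d {x, y, z}"
    if "x \<subseteq> {..<d}" "y \<subseteq> {..<d}" "z \<subseteq> {..<d}" "x \<noteq> y" "x \<inter> z = {}" "y \<inter> z = {}"
      "k \<in> z" "k' \<in> z" "k \<noteq> k'" for x y z k k'
  proof -
    \<comment> \<open>Translation by \<open>x\<close> moves \<open>x\<close> to the origin; by
      disjointness \<open>k\<close> and \<open>k'\<close> stay in the third set and outside the
      second.\<close>
    have "versatile d {{}, sym_diff x y, sym_diff x z}"
      by (rule versatile_far[of _ _ _ k k']) (use that in auto)
    from versatile_translate[OF this that(1)] show ?thesis
      by simp
  qed
  have small: "w = {} \<or> (\<exists>k. w = {k})" if "\<nexists>k k'. k \<in> w \<and> k' \<in> w \<and> k \<noteq> k'" for w :: "nat set"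
    using that by blast
  show ?thesis
  proof (cases "\<exists>w\<in>{x, y, z}. \<exists>k k'. k \<in> w \<and> k' \<in> w \<and> k \<noteq> k'")
    case True
    then obtain w k k' where w: "w \<in> {x, y, z}" "k \<in> w" "k' \<in> w" "k \<noteq> k'"
      by blast
    have "versatile d {x, y, z}" if "w = z"
      using far[of x y z k k'] w that assms by simp
    moreover have "versatile d {z, x, y}" if "w = y"
      using far[of z x y k k'] w that assms by (simp add: Int_commute)
    moreover have "versatile d {y, z, x}" if "w = x"
      using far[of y z x k k'] w that assms by (simp add: Int_commute)
    ultimately show ?thesis
      using w(1) by (auto simp: insert_commute)
  next
    case False
    then have s: "x = {} \<or> (\<exists>k. x = {k})" "y = {} \<or> (\<exists>k. y = {k})" "z = {} \<or> (\<exists>k. z = {k})"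
      using small[of x] small[of y] small[of z] by simp_all
    show ?thesis
    proof (cases "{} \<in> {x, y, z}")
      case True
      then consider "x = {}" | "y = {}" | "z = {}"
        by blast
      then show ?thesis
      proof cases
        case 1
        then show ?thesis
          using s assms versatile_corner[of _ d] by auto
      next
        case 2
        then show ?thesis
          using s assms versatile_corner[of _ d] by (auto simp: insert_commute)
      next
        case 3
        then show ?thesis
          using s assms versatile_corner[of _ d] by (auto simp: insert_commute)
      qed
    next
      case False
      then show ?thesis
        using s assms versatile_tripod[of _ d] by auto
    qed
  qed
qed

text \<open>Translating by the majority vector makes three vertices pairwise disjoint.\<close>

lemma versatile_three:
  assumes "X \<subseteq> Pow {..<d}" "card X = 3"
  shows "versatile d X"
proof -
  obtain x y z where X: "X = {x, y, z}" and distinct: "x \<noteq> y" "x \<noteq> z" "y \<noteq> z"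
    using assms(2) by (auto simp: card_3_iff)
  have sub: "x \<subseteq> {..<d}" "y \<subseteq> {..<d}" "z \<subseteq> {..<d}"
    using assms(1) X by auto
  define t where "t = x \<inter> y \<union> y \<inter> z \<union> x \<inter> z"
  have t: "t \<subseteq> {..<d}"
    using sub by (auto simp: t_def)
  have ne: "sym_diff t u \<noteq> sym_diff t v" if "u \<noteq> v" for u v
    using that by (metis sym_diff_cancel)
  have "versatile d {sym_diff t x, sym_diff t y, sym_diff t z}"
  proof (rule versatile_disjoint)
    show "sym_diff t x \<inter> sym_diff t y = {}" "sym_diff t x \<inter> sym_diff t z = {}"
      "sym_diff t y \<inter> sym_diff t z = {}"
      unfolding t_def by blast+
  qed (use sub t distinct ne in auto)
  from versatile_translate[OF this t] show ?thesis
    by (simp add: X)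
qed

section \<open>Exits around a prescribed vertex\<close>

lemma exitable_one_at:
  assumes "w \<subseteq> {..<d}" "x \<subseteq> {..<d}"
  shows "exitable d {w} (\<lambda>i. {flip i x})"
proof -
  have "exitable d {sym_diff x w} (\<lambda>i. {{i}})"
    using assms by (intro exitable_one) auto
  from exitable_translate[OF this assms(2)] show ?thesis
    by (simp add: flip_sym_diff[of _ x "{}", simplified, symmetric])
qed

lemma exitable_two_at:
  assumes "x \<subseteq> {..<d}" "y \<subseteq> {..<d}" "x \<noteq> y"
  shows "exitable d {x, y} (\<lambda>i. if flip i x = a then {x} else {flip i x})"
proof -
  have "exitable d {{}, sym_diff x y} (\<lambda>i. if {i} = sym_diff x a then {{}} else {{i}})"
    using assms by (intro exitable_two) auto
  from exitable_translate[OF this assms(1)]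
  have "exitable d {x, y} (\<lambda>i. sym_diff x ` (if {i} = sym_diff x a then {{}} else {{i}}))"
    by simp
  moreover have "sym_diff x ` (if {i} = sym_diff x a then {{}} else {{i}}) =
      (if flip i x = a then {x} else {flip i x})" for i
  proof -
    have flip: "flip i x = sym_diff x {i}"
      using flip_sym_diff[of i x "{}"] by simp
    then have "{i} = sym_diff x a \<longleftrightarrow> flip i x = a"
      by (metis sym_diff_cancel)
    then show ?thesis
      by (simp add: flip)
  qed
  ultimately show ?thesis
    by simp
qed

subsection \<open>Assembly in the dual cube\<close>

text \<open>Edges within \<open>V1\<close>, within \<open>V2\<close> and touching some
  \<open>Z i\<close> are mutually exclusive kinds, and different pieces share none of the same kind.
  In the application \<open>V1\<close> and \<open>V2\<close> are clusters and \<open>Z i\<close> is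
  the outside region that joins up piece \<open>i\<close>.\<close>

lemma system_union:
  assumes s1: "system adj V1 m S1 W1 A1" and s2: "system adj V2 m S2 W2 A2"
    and V: "V1 \<subseteq> V" "V2 \<subseteq> V" "V1 \<inter> V2 = {}"
    and Z: "\<And>i. i < m \<Longrightarrow> Z i \<subseteq> V - V1 - V2"
    and Zd: "\<And>i j. i < m \<Longrightarrow> j < m \<Longrightarrow> i \<noteq> j \<Longrightarrow> Z i \<inter> Z j = {}"
  shows "system adj V m (S1 \<union> S2) (\<lambda>i. W1 i \<union> W2 i \<union> Z i)
    (\<lambda>i. A1 i \<union> A2 i \<union> piece adj (S1 \<union> W1 i \<union> S2 \<union> W2 i) (Z i))"
proof -
  let ?B = "\<lambda>i. piece adj (S1 \<union> W1 i \<union> S2 \<union> W2 i) (Z i)"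
  have S: "S1 \<subseteq> V1" "S2 \<subseteq> V2"
    and W: "\<And>i. i < m \<Longrightarrow> W1 i \<subseteq> V1 - S1" "\<And>i. i < m \<Longrightarrow> W2 i \<subseteq> V2 - S2"
    and A: "\<And>i. i < m \<Longrightarrow> A1 i \<subseteq> {{u, v} | u v. adj u v \<and> u \<in> S1 \<union> W1 i \<and> v \<in> S1 \<union> W1 i}"
      "\<And>i. i < m \<Longrightarrow> A2 i \<subseteq> {{u, v} | u v. adj u v \<and> u \<in> S2 \<union> W2 i \<and> v \<in> S2 \<union> W2 i}"
    and Wd: "\<And>i j. i < m \<Longrightarrow> j < m \<Longrightarrow> i \<noteq> j \<Longrightarrow> W1 i \<inter> W1 j = {}"
      "\<And>i j. i < m \<Longrightarrow> j < m \<Longrightarrow> i \<noteq> j \<Longrightarrow> W2 i \<inter> W2 j = {}"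
    and Ad: "\<And>i j. i < m \<Longrightarrow> j < m \<Longrightarrow> i \<noteq> j \<Longrightarrow> A1 i \<inter> A1 j = {}"
      "\<And>i j. i < m \<Longrightarrow> j < m \<Longrightarrow> i \<noteq> j \<Longrightarrow> A2 i \<inter> A2 j = {}"
    using s1 s2 by (simp_all add: system_def)
  have e1: "e \<subseteq> V1 \<and> e \<noteq> {}" if e: "e \<in> A1 i" and i: "i < m" for e i
  proof -
    obtain u v where "e = {u, v}" "u \<in> S1 \<union> W1 i" "v \<in> S1 \<union> W1 i"
      using subsetD[OF A(1)[OF i] e] by auto
    then show ?thesis
      using S(1) W(1)[OF i] by auto
  qed
  have e2: "e \<subseteq> V2 \<and> e \<noteq> {}" if e: "e \<in> A2 i" and i: "i < m" for e i
  proof -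
    obtain u v where "e = {u, v}" "u \<in> S2 \<union> W2 i" "v \<in> S2 \<union> W2 i"
      using subsetD[OF A(2)[OF i] e] by auto
    then show ?thesis
      using S(2) W(2)[OF i] by auto
  qed
  have e3: "e \<inter> Z i \<noteq> {} \<and> e \<subseteq> V1 \<union> V2 \<union> Z i" if e: "e \<in> ?B i" and i: "i < m" for e i
  proof -
    obtain u v where "e = {u, v}" "u \<in> Z i" "v \<in> S1 \<union> W1 i \<union> S2 \<union> W2 i \<union> Z i"
      using e by (auto simp: piece_def)
    then show ?thesis
      using S W[OF i] by auto
  qed
  have "(A1 i \<union> A2 i \<union> ?B i) \<inter> (A1 j \<union> A2 j \<union> ?B j) = {}"
    if ij: "i < m" "j < m" "i \<noteq> j" for i j
  proof (rule ccontr)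
    assume "(A1 i \<union> A2 i \<union> ?B i) \<inter> (A1 j \<union> A2 j \<union> ?B j) \<noteq> {}"
    then obtain e where "e \<in> A1 i \<or> e \<in> A2 i \<or> e \<in> ?B i" "e \<in> A1 j \<or> e \<in> A2 j \<or> e \<in> ?B j"
      by auto
    moreover have "\<not> (e \<in> A1 i \<and> e \<in> A1 j)" "\<not> (e \<in> A2 i \<and> e \<in> A2 j)"
      using Ad(1)[OF ij] Ad(2)[OF ij] by auto
    moreover have "\<not> (e \<subseteq> V1 \<and> e \<noteq> {} \<and> e \<subseteq> V2)"
      using V(3) by auto
    moreover have "\<not> (e \<subseteq> V1 \<and> e \<inter> Z k \<noteq> {})" "\<not> (e \<subseteq> V2 \<and> e \<inter> Z k \<noteq> {})" if "k < m" for k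
      using Z[OF that] by auto
    moreover have "\<not> (e \<inter> Z i \<noteq> {} \<and> e \<subseteq> V1 \<union> V2 \<union> Z j)"
      using Z[OF ij(1)] Zd[OF ij] by blast
    ultimately show False
      using e1 e2 e3 ij(1,2) by metis
  qed
  moreover have "(W1 i \<union> W2 i \<union> Z i) \<inter> (W1 j \<union> W2 j \<union> Z j) = {}"
    if ij: "i < m" "j < m" "i \<noteq> j" for i j
    using Wd(1)[OF ij] Wd(2)[OF ij] W[OF ij(1)] W[OF ij(2)] Z[OF ij(1)] Z[OF ij(2)] Zd[OF ij] V(3)
    by blast
  moreover have "W1 i \<union> W2 i \<union> Z i \<subseteq> V - (S1 \<union> S2)" if "i < m" for i
    using W[OF that] Z[OF that] S V by blast
  moreover have "A1 i \<union> A2 i \<union> ?B i \<subseteq> {{u, v} | u v. adj u v \<and>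
      u \<in> S1 \<union> S2 \<union> (W1 i \<union> W2 i \<union> Z i) \<and> v \<in> S1 \<union> S2 \<union> (W1 i \<union> W2 i \<union> Z i)}" if "i < m" for i
  proof (intro Un_least)
    let ?T = "{{u, v} | u v. adj u v \<and> u \<in> S1 \<union> S2 \<union> (W1 i \<union> W2 i \<union> Z i) \<and>
      v \<in> S1 \<union> S2 \<union> (W1 i \<union> W2 i \<union> Z i)}"
    show "A1 i \<subseteq> ?T"
      by (rule order_trans[OF A(1)[OF that]], intro Collect_mono) blast
    show "A2 i \<subseteq> ?T"
      by (rule order_trans[OF A(2)[OF that]], intro Collect_mono) blast
    show "?B i \<subseteq> ?T"
      unfolding piece_def by (intro Collect_mono) blast
  qed
  moreover have "S1 \<union> S2 \<subseteq> V"
    using S V by blast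
  ultimately show ?thesis
    by (simp add: system_def)
qed

section \<open>The dual cube as a union of clusters\<close>

text \<open>A vertex \<open>(c, p, q)\<close> has class \<open>c\<close>, lies in the cluster of class \<open>c\<close> indexed by \<open>p\<close>, and
  has position \<open>q\<close> in it; switching the class exchanges the roles of \<open>p\<close> and \<open>q\<close>.\<close>

type_synonym vertex = "bool \<times> nat set \<times> nat set"

definition dual_verts :: "nat \<Rightarrow> vertex set" where
  "dual_verts d = UNIV \<times> Pow {..<d} \<times> Pow {..<d}"

definition dual_adj :: "nat \<Rightarrow> vertex \<Rightarrow> vertex \<Rightarrow> bool" where
  "dual_adj d u v = (case (u, v) of ((c, p, q), (c', p', q')) \<Rightarrow>
     c' = c \<and> p' = p \<and> cube_adj d q q' \<or> c' = (\<not> c) \<and> p' = q \<and> q' = p)"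

lemma dual_adj_cross: "dual_adj d (c, p, q) (\<not> c, q, p)"
  by (simp add: dual_adj_def)

lemma dual_adj_cluster: "dual_adj d (c, p, q) (c, p, q') \<longleftrightarrow> cube_adj d q q'"
  by (simp add: dual_adj_def)

text \<open>Inside a cluster every position descends to \<open>{}\<close> by removing elements; the
  clusters \<open>(c, p)\<close> and \<open>(\<not> c, p')\<close> are joined by the edge from
  position \<open>p'\<close> in the first to position \<open>p\<close> in the second.\<close>

lemma hub_connected:
  assumes K: "K \<subseteq> UNIV \<times> Pow {..<d}" "(True, a) \<in> K" "(False, b) \<in> K"
    and Z: "Z = {(c, p, q). (c, p) \<in> K \<and> q \<subseteq> {..<d}}" and v: "v \<in> Z"
  shows "reach (piece (dual_adj d) Y Z) v (True, a, {})"
    (is "reach ?A _ _")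
proof -
  have inside: "reach ?A (c, p, q) (c, p, {})" if "(c, p) \<in> K" "q \<subseteq> {..<d}" for c p q
  proof -
    have "finite q"
      using that(2) finite_subset by blast
    then show ?thesis
      using that(2)
    proof (induction q rule: finite_induct)
      case (insert x q)
      have "{(c, p, insert x q), (c, p, q)} \<in> ?A"
        using insert that(1) Z by (intro pieceI) (auto simp: dual_adj_cluster intro: cube_adj_insert')
      then have "reach ?A (c, p, insert x q) (c, p, q)"
        by (rule reach_edge)
      moreover have "reach ?A (c, p, q) (c, p, {})"
        using insert by simp
      ultimately show ?case
        by (rule reach_trans)
    qed simp
  qed
  have cross: "reach ?A (c, p, {}) (\<not> c, p', {})" if "(c, p) \<in> K" "(\<not> c, p') \<in> K" for c p p'
  proof -
    have sub: "p \<subseteq> {..<d}" "p' \<subseteq> {..<d}"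
      using K(1) that by auto
    have "{(c, p, p'), (\<not> c, p', p)} \<in> ?A"
      using that sub Z by (intro pieceI dual_adj_cross) auto
    then have "reach ?A (c, p, p') (\<not> c, p', p)"
      by (rule reach_edge)
    then show ?thesis
      using inside[OF that(1) sub(2)] inside[OF that(2) sub(1)]
      by (meson reach_sym reach_trans)
  qed
  obtain c p q where cpq: "v = (c, p, q)" "(c, p) \<in> K" "q \<subseteq> {..<d}"
    using v Z by auto
  \<comment> \<open>No edge joins two clusters of the same class, so from class \<open>True\<close>
    the way goes through \<open>(False, b)\<close>.\<close>
  have "reach ?A (c, p, {}) (True, a, {})"
  proof (cases c)
    case True
    have "reach ?A (c, p, {}) (False, b, {})"
      using cross[of c p b] cpq K True by simp
    also have "reach ?A (False, b, {}) (True, a, {})"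
      using cross[of False b a] K by simp
    finally show ?thesis .
  next
    case False
    then show ?thesis
      using cross[of c p a] cpq K by simp
  qed
  then show ?thesis
    using inside[OF cpq(2,3)] cpq(1) by (blast intro: reach_trans)
qed

text \<open>Connected subgraphs that pairwise share no edge and only the vertices of
  \<open>S\<close>; trees appear only after the passage to bit strings.\<close>

definition packable :: "nat \<Rightarrow> vertex set \<Rightarrow> bool" where
  "packable d S \<longleftrightarrow> (\<exists>W A. system (dual_adj d) (dual_verts d) d S W A \<and>
     (\<forall>i<d. \<forall>u\<in>S \<union> W i. \<forall>v\<in>S \<union> W i. reach (A i) u v))"

text \<open>\<open>K i\<close> is the set of clusters reserved for piece \<open>i\<close>. The cross
  edge at \<open>(c, p, e)\<close> leads to \<open>(\<not> c, e, p)\<close>, so the position of an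
  exit is the index of the cluster entered; hence the form of \<open>K_exit\<close>. With both
  classes present, the reserved clusters form a connected hub that every vertex of the piece
  reaches.\<close>

lemma packable_clusters:
  assumes p: "p1 \<subseteq> {..<d}" "p2 \<subseteq> {..<d}" "(c1, p1) \<noteq> (c2, p2)"
    and ex: "exitable d X1 E1" "exitable d X2 E2"
    and K: "\<And>i. i < d \<Longrightarrow> K i \<subseteq> UNIV \<times> Pow {..<d} - {(c1, p1), (c2, p2)}"
    and Kd: "\<And>i j. i < d \<Longrightarrow> j < d \<Longrightarrow> i \<noteq> j \<Longrightarrow> K i \<inter> K j = {}"
    and K_class: "\<And>i c. i < d \<Longrightarrow> \<exists>a. (c, a) \<in> K i"
    and K_exit: "\<And>i e. i < d \<Longrightarrow> e \<in> E1 i \<Longrightarrow> (\<not> c1, e) \<in> K i"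
      "\<And>i e. i < d \<Longrightarrow> e \<in> E2 i \<Longrightarrow> (\<not> c2, e) \<in> K i"
  shows "packable d (Pair c1 ` Pair p1 ` X1 \<union> Pair c2 ` Pair p2 ` X2)"
proof -
  have cluster: "\<exists>W A. system (dual_adj d) ({c} \<times> {p} \<times> Pow {..<d}) d (Pair c ` Pair p ` X) W A \<and>
      exits d (Pair c ` Pair p ` X) W A (\<lambda>i. Pair c ` Pair p ` E i)" if "exitable d X E" for c p X E
  proof -
    let ?f = "\<lambda>q. (c, p, q)"
    obtain W A where s: "system (cube_adj d) (Pow {..<d}) d X W A" and e: "exits d X W A E"
      using \<open>exitable d X E\<close> by (auto simp: exitable_def)
    have inj: "inj_on ?f (Pow {..<d})"
      by (rule inj_onI) simp
    have "system (dual_adj d) ({c} \<times> {p} \<times> Pow {..<d}) d (?f ` X) (\<lambda>i. ?f ` W i) (\<lambda>i. (`) ?f ` A i)"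
      by (rule system_image[OF s inj]) (auto simp: dual_adj_cluster)
    moreover have "exits d (?f ` X) (\<lambda>i. ?f ` W i) (\<lambda>i. (`) ?f ` A i) (\<lambda>i. ?f ` E i)"
      using s by (intro exits_image[OF e inj]) (auto simp: system_def)
    moreover have "Pair c ` Pair p ` Y = ?f ` Y" for Y :: "nat set set"
      by (simp add: image_image)
    ultimately show ?thesis
      by (intro exI conjI) auto
  qed
  let ?S1 = "Pair c1 ` Pair p1 ` X1" and ?S2 = "Pair c2 ` Pair p2 ` X2"
  let ?V1 = "{c1} \<times> {p1} \<times> Pow {..<d}" and ?V2 = "{c2} \<times> {p2} \<times> Pow {..<d}"
  obtain W1 A1 where s1: "system (dual_adj d) ?V1 d ?S1 W1 A1"
    and x1: "exits d ?S1 W1 A1 (\<lambda>i. Pair c1 ` Pair p1 ` E1 i)"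
    using cluster[OF ex(1)] by blast
  obtain W2 A2 where s2: "system (dual_adj d) ?V2 d ?S2 W2 A2"
    and x2: "exits d ?S2 W2 A2 (\<lambda>i. Pair c2 ` Pair p2 ` E2 i)"
    using cluster[OF ex(2)] by blast
  define Z where "Z i = {(c, p, q). (c, p) \<in> K i \<and> q \<subseteq> {..<d}}" for i
  let ?B = "\<lambda>i. piece (dual_adj d) (?S1 \<union> W1 i \<union> ?S2 \<union> W2 i) (Z i)"
  let ?W = "\<lambda>i. W1 i \<union> W2 i \<union> Z i" and ?A = "\<lambda>i. A1 i \<union> A2 i \<union> ?B i"
  have "system (dual_adj d) (dual_verts d) d (?S1 \<union> ?S2) ?W ?A"
  proof (rule system_union[OF s1 s2])
    show "?V1 \<inter> ?V2 = {}"
      using p(3) by auto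
    show "Z i \<subseteq> dual_verts d - ?V1 - ?V2" if "i < d" for i
      using K[OF that] by (auto simp: Z_def dual_verts_def)
    show "Z i \<inter> Z j = {}" if "i < d" "j < d" "i \<noteq> j" for i j
      using Kd[OF that] by (auto simp: Z_def)
  qed (use p in \<open>auto simp: dual_verts_def\<close>)
  moreover have "reach (?A i) u v" if i: "i < d" and uv: "u \<in> ?S1 \<union> ?S2 \<union> ?W i" "v \<in> ?S1 \<union> ?S2 \<union> ?W i"
    for i u v
  proof -
    obtain a b where ab: "(True, a) \<in> K i" "(False, b) \<in> K i"
      using K_class[OF i] by blast
    let ?h = "(True, a, {}) :: vertex"
    have "K i \<subseteq> UNIV \<times> Pow {..<d}"
      using K[OF i] by blast
    then have "reach (?B i) v ?h" if "v \<in> Z i" for v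
      by (rule hub_connected[OF _ ab Z_def that])
    then have hub: "reach (?A i) v ?h" if "v \<in> Z i" for v
      using that by (blast intro: reach_mono)
    \<comment> \<open>Stated for a generic cluster so as to serve both: walk within the piece to an
      exit, cross over, and continue in the hub.\<close>
    have out: "reach (?A i) v ?h"
      if x: "exits d S' W' A' (\<lambda>i. Pair c ` Pair p ` E i)" and A': "A' i \<subseteq> ?A i"
        and S': "S' \<union> W' i \<subseteq> ?S1 \<union> W1 i \<union> ?S2 \<union> W2 i" and p: "p \<subseteq> {..<d}"
        and E: "\<And>e. e \<in> E i \<Longrightarrow> (\<not> c, e) \<in> K i" and v: "v \<in> S' \<union> W' i"
      for S' W' A' c p E v
    proof -
      have sub: "Pair c ` Pair p ` E i \<subseteq> S' \<union> W' i"
        and "\<forall>v\<in>S' \<union> W' i. \<exists>e\<in>Pair c ` Pair p ` E i. reach (A' i) v e"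
        using x i by (simp_all add: exits_def)
      then obtain e where e: "e \<in> E i" "reach (A' i) v (c, p, e)"
        using v by blast
      have mem: "(c, p, e) \<in> S' \<union> W' i"
        using sub e(1) by blast
      have Z: "(\<not> c, e, p) \<in> Z i"
        using E[OF e(1)] p by (simp add: Z_def)
      have "{(\<not> c, e, p), (c, p, e)} \<in> ?B i"
        using dual_adj_cross[of d "\<not> c" e p] mem S' Z by (intro pieceI) auto
      then have "reach (?A i) (\<not> c, e, p) (c, p, e)"
        by (intro reach_edge) simp
      moreover have "reach (?A i) v (c, p, e)"
        by (rule reach_mono[OF e(2) A'])
      ultimately show ?thesis
        using hub[OF Z] by (meson reach_sym reach_trans)
    qed
    have out1: "reach (?A i) v ?h" if "v \<in> ?S1 \<union> W1 i" for v
      by (rule out[OF x1 _ _ p(1) K_exit(1)[OF i] that]) auto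
    have out2: "reach (?A i) v ?h" if "v \<in> ?S2 \<union> W2 i" for v
      by (rule out[OF x2 _ _ p(2) K_exit(2)[OF i] that]) auto
    have "reach (?A i) w ?h" if "w \<in> ?S1 \<union> ?S2 \<union> ?W i" for w
      using that out1 out2 hub by blast
    from reach_trans[OF this[OF uv(1)] reach_sym[OF this[OF uv(2)]]] show ?thesis .
  qed
  ultimately show ?thesis
    unfolding packable_def by (intro exI conjI) auto
qed

section \<open>Choosing exits in two clusters\<close>

lemma exitableD:
  assumes "exitable d X E" "i < d"
  shows "E i \<subseteq> Pow {..<d}" "X \<noteq> {} \<Longrightarrow> E i \<noteq> {}" "j < d \<Longrightarrow> i \<noteq> j \<Longrightarrow> E i \<inter> E j = {}"
proof -
  obtain W A where s: "system (cube_adj d) (Pow {..<d}) d X W A" and e: "exits d X W A E"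
    using assms(1) by (auto simp: exitable_def)
  have V: "X \<subseteq> Pow {..<d}" "W i \<subseteq> Pow {..<d}"
    using s assms(2) by (auto simp: system_def)
  have E: "E i \<subseteq> X \<union> W i" and r: "\<forall>v\<in>X \<union> W i. \<exists>e\<in>E i. reach (A i) v e"
    using e assms(2) by (simp_all add: exits_def)
  show "E i \<subseteq> Pow {..<d}"
    using E V by blast
  show "E i \<noteq> {}" if "X \<noteq> {}"
    using r that by blast
  show "E i \<inter> E j = {}" if "j < d" "i \<noteq> j"
    using e assms(2) that by (simp add: exits_def)
qed

text \<open>Applied with \<open>a\<close> the index of the other cluster when the classes differ: an
  exit at position \<open>a\<close> would lead straight into that cluster.\<close>

lemma exitable_avoiding:
  assumes "X \<subseteq> Pow {..<d}" "card X \<in> {1, 2, 3}" "a \<subseteq> {..<d}"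
  obtains E where "exitable d X E" "\<And>i. i < d \<Longrightarrow> a \<notin> E i"
proof -
  consider "card X = 1" | "card X = 2" | "card X = 3"
    using assms(2) by auto
  then have "\<exists>E. exitable d X E \<and> (\<forall>i<d. a \<notin> E i)"
  proof cases
    case 1
    then obtain w where "X = {w}"
      by (auto simp: card_1_singleton_iff)
    \<comment> \<open>The exits are the neighbours of \<open>a\<close>, so \<open>a\<close> itself
      is none of them.\<close>
    then show ?thesis
      using exitable_one_at[of w d a] assms by (intro exI[of _ "\<lambda>i. {flip i a}"]) auto
  next
    case 2
    then obtain x y where X: "X = {x, y}" "x \<noteq> y"
      by (auto simp: card_2_iff)
    have "a \<notin> (if flip i x = a then {x} else {flip i x})" for i
      by auto
    moreover have "exitable d X (\<lambda>i. if flip i x = a then {x} else {flip i x})"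
      using exitable_two_at[of x d y a] assms X by auto
    ultimately show ?thesis
      by blast
  next
    case 3
    then show ?thesis
      using versatile_three[OF assms(1)] by (simp add: versatile_def)
  qed
  then show thesis
    using that by blast
qed

text \<open>Either equation writes the symmetric difference of \<open>x\<close> and \<open>y\<close>
  as that of two singletons; if it has two elements, these are determined up to order.\<close>

lemma flip_eq_flip:
  assumes "flip i x = flip k y" "flip i' x = flip k' y" "i' \<noteq> k'"
  shows "i = i' \<and> k = k' \<or> i = k' \<and> k = i'"
proof -
  have mem: "m \<in> flip j u \<longleftrightarrow> (m \<in> u) \<noteq> (m = j)" for m j u
    by (auto simp: flip_def)
  have "((m = i) = (m = k)) = ((m = i') = (m = k'))" for m
    using mem[of m i x] mem[of m k y] mem[of m i' x] mem[of m k' y] assms(1,2) by auto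
  from this[of i'] this[of k'] show ?thesis
    using assms(3) by auto
qed

text \<open>From two clusters of the same class, exits at equal positions lead to the same cluster,
  so a common exit position must belong to the same piece on both sides.\<close>

lemma exitable_aligned:
  assumes X: "X1 \<subseteq> Pow {..<d}" "X2 \<subseteq> Pow {..<d}"
    and card: "card X1 = 3 \<and> card X2 = 1 \<or> card X1 = 2 \<and> card X2 = 2"
  obtains E1 E2 where "exitable d X1 E1" "exitable d X2 E2"
    "\<And>i j. i < d \<Longrightarrow> j < d \<Longrightarrow> i \<noteq> j \<Longrightarrow> (E1 i \<union> E2 i) \<inter> (E1 j \<union> E2 j) = {}"
proof (cases "card X1 = 3")
  case True
  then obtain u E where u: "u \<subseteq> {..<d}" and E: "exitable d X1 E" "\<forall>i<d. flip i u \<in> E i"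
    using versatile_three[OF X(1)] by (auto simp: versatile_def)
  obtain w where w: "X2 = {w}"
    using card True by (auto simp: card_1_singleton_iff)
  \<comment> \<open>The \<open>i\<close>-th exit of the single vertex is the flip of
    \<open>u\<close> that is already an exit of piece \<open>i\<close> on the other side.\<close>
  have "exitable d X2 (\<lambda>i. {flip i u})"
    using exitable_one_at[of w d u] u w X(2) by simp
  moreover have "(E i \<union> {flip i u}) \<inter> (E j \<union> {flip j u}) = {}" if "i < d" "j < d" "i \<noteq> j" for i j
    using exitableD(3)[OF E(1) that] E(2) that(1,2) by (simp add: insert_absorb)
  ultimately show thesis
    using that[OF E(1)] by blast
next
  case False
  then obtain x y x' y' where xy: "X1 = {x, y}" "x \<noteq> y" "X2 = {x', y'}" "x' \<noteq> y'"
    using card by (auto simp: card_2_iff)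
  \<comment> \<open>Avoiding \<open>x\<close> changes nothing, as \<open>x\<close> is not its own
    neighbour; the exits are exactly the neighbours of \<open>x\<close>.\<close>
  have ex: "exitable d {x, y} (\<lambda>i. {flip i x})" if "x \<subseteq> {..<d}" "y \<subseteq> {..<d}" "x \<noteq> y" for x y
    using exitable_two_at[OF that, of x] by simp
  \<comment> \<open>A clash between pieces \<open>i \<noteq> k\<close> means that \<open>x\<close>
    and \<open>x'\<close> differ exactly in the coordinates \<open>i\<close> and \<open>k\<close>.
    These two then give the only coincidences, and swapping them on the second side aligns
    them.\<close>
  have "\<exists>\<sigma>. bij_betw \<sigma> {..<d} {..<d} \<and> (\<forall>i<d. \<forall>j<d. flip i x = flip (\<sigma> j) x' \<longrightarrow> i = j)"
  proof (cases "\<exists>i k. i < d \<and> k < d \<and> i \<noteq> k \<and> flip i x = flip k x'")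
    case True
    then obtain i k where ik: "i < d" "k < d" "i \<noteq> k" "flip i x = flip k x'"
      by blast
    define \<sigma> where "\<sigma> j = (if j = i then k else if j = k then i else j)" for j
    have "bij_betw \<sigma> {..<d} {..<d}"
      by (rule bij_betw_byWitness[where f' = \<sigma>]) (use ik in \<open>auto simp: \<sigma>_def\<close>)
    moreover have "i' = j" if "flip i' x = flip (\<sigma> j) x'" for i' j
      using flip_eq_flip[OF that ik(4,3)] by (auto simp: \<sigma>_def split: if_splits)
    ultimately show ?thesis
      by blast
  next
    case False
    then show ?thesis
      by (intro exI[of _ "\<lambda>i. i"]) (auto simp: bij_betw_def)
  qed
  then obtain \<sigma> where \<sigma>: "bij_betw \<sigma> {..<d} {..<d}"
    and ne: "\<And>i j. i < d \<Longrightarrow> j < d \<Longrightarrow> i \<noteq> j \<Longrightarrow> flip i x \<noteq> flip (\<sigma> j) x'"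
    by blast
  have "exitable d X1 (\<lambda>i. {flip i x})"
    using ex[of x y] xy X by simp
  moreover have "exitable d X2 (\<lambda>i. {flip (\<sigma> i) x'})"
    using exitable_reindex[OF ex[of x' y'] \<sigma>] xy X by simp
  moreover have "({flip i x} \<union> {flip (\<sigma> i) x'}) \<inter> ({flip j x} \<union> {flip (\<sigma> j) x'}) = {}"
    if "i < d" "j < d" "i \<noteq> j" for i j
  proof -
    have "\<sigma> i \<noteq> \<sigma> j"
      using \<sigma> that by (auto simp: bij_betw_def dest: inj_onD)
    then show ?thesis
      using ne[of i j] ne[of j i] that by (simp add: flip_inj)
  qed
  ultimately show thesis
    by (rule that)
qed

text \<open>For equal classes all exits lead to the opposite class, so each piece also receives a
  private cluster \<open>h i\<close> of the original class; \<open>2 ^ d - 2 \<ge> d\<close> of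
  these are available. For different classes the exits of the two sides enter different classes, so
  they never collide and already supply both classes.\<close>

lemma packable_two_clusters:
  assumes d: "3 \<le> d" and p: "p1 \<subseteq> {..<d}" "p2 \<subseteq> {..<d}" "(c1, p1) \<noteq> (c2, p2)"
    and X: "X1 \<subseteq> Pow {..<d}" "X2 \<subseteq> Pow {..<d}"
    and card: "card X1 = 3 \<and> card X2 = 1 \<or> card X1 = 2 \<and> card X2 = 2"
  shows "packable d (Pair c1 ` Pair p1 ` X1 \<union> Pair c2 ` Pair p2 ` X2)"
proof -
  have Xne: "X1 \<noteq> {}" "X2 \<noteq> {}"
    using card by auto
  show ?thesis
  proof (cases "c1 = c2")
    case True
    obtain E1 E2 where E: "exitable d X1 E1" "exitable d X2 E2"
      and Ed: "\<And>i j. i < d \<Longrightarrow> j < d \<Longrightarrow> i \<noteq> j \<Longrightarrow> (E1 i \<union> E2 i) \<inter> (E1 j \<union> E2 j) = {}"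
      by (fact exitable_aligned[OF X card])
    have "card {..<d} \<le> card (Pow {..<d} - {p1, p2})"
    proof -
      have "d + 2 \<le> 2 ^ d"
        using d by (induction d rule: dec_induct) auto
      moreover have "card (Pow {..<d}) - card {p1, p2} \<le> card (Pow {..<d} - {p1, p2})"
        by (rule diff_card_le_card_Diff) simp
      moreover have "card {p1, p2} \<le> 2"
        by (simp add: card_insert_if)
      ultimately show ?thesis
        by (simp add: card_Pow)
    qed
    then obtain h where h: "inj_on h {..<d}" "h ` {..<d} \<subseteq> Pow {..<d} - {p1, p2}"
      using card_le_inj[of "{..<d}" "Pow {..<d} - {p1, p2}"] by auto
    define K where "K i = {\<not> c1} \<times> (E1 i \<union> E2 i) \<union> {(c1, h i)}" for i
    show ?thesis
    proof (rule packable_clusters[OF p E, of K])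
      fix i assume i: "i < d"
      have hi: "h i \<in> Pow {..<d} - {p1, p2}"
        using h(2) i by blast
      then show "K i \<subseteq> UNIV \<times> Pow {..<d} - {(c1, p1), (c2, p2)}"
        using exitableD(1)[OF E(1) i] exitableD(1)[OF E(2) i] True by (auto simp: K_def)
      show "K i \<inter> K j = {}" if "j < d" "i \<noteq> j" for j
      proof -
        have "h i \<noteq> h j"
          using h(1) i that by (auto dest: inj_onD)
        then show ?thesis
          using Ed[OF i that] by (auto simp: K_def)
      qed
      have "E1 i \<noteq> {}"
        by (rule exitableD(2)[OF E(1) i Xne(1)])
      then show "\<exists>a. (c, a) \<in> K i" for c
        by (cases "c = c1") (auto simp: K_def)
    qed (use True in \<open>auto simp: K_def\<close>)
  next
    case False
    have small: "card X1 \<in> {1, 2, 3}" "card X2 \<in> {1, 2, 3}"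
      using card by auto
    obtain E1 where E1: "exitable d X1 E1" "\<And>i. i < d \<Longrightarrow> p2 \<notin> E1 i"
      by (fact exitable_avoiding[OF X(1) small(1) p(2)])
    obtain E2 where E2: "exitable d X2 E2" "\<And>i. i < d \<Longrightarrow> p1 \<notin> E2 i"
      by (fact exitable_avoiding[OF X(2) small(2) p(1)])
    define K where "K i = {\<not> c1} \<times> E1 i \<union> {\<not> c2} \<times> E2 i" for i
    show ?thesis
    proof (rule packable_clusters[OF p E1(1) E2(1), of K])
      fix i assume i: "i < d"
      show "K i \<subseteq> UNIV \<times> Pow {..<d} - {(c1, p1), (c2, p2)}"
        using exitableD(1)[OF E1(1) i] exitableD(1)[OF E2(1) i] E1(2)[OF i] E2(2)[OF i] False
        by (auto simp: K_def)
      show "K i \<inter> K j = {}" if "j < d" "i \<noteq> j" for j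
        using exitableD(3)[OF E1(1) i that] exitableD(3)[OF E2(1) i that] False by (auto simp: K_def)
      note exitableD(2)[OF E1(1) i Xne(1)] exitableD(2)[OF E2(1) i Xne(2)]
      then show "\<exists>a. (c, a) \<in> K i" for c
        using False by (cases "c = c1") (auto simp: K_def)
    qed (auto simp: K_def)
  qed
qed

definition cluster_of :: "vertex \<Rightarrow> bool \<times> nat set" where
  "cluster_of v = (fst v, fst (snd v))"

lemma packable_four:
  assumes d: "3 \<le> d" and S: "S \<subseteq> dual_verts d" "card S = 4" "card (cluster_of ` S) = 2"
  shows "packable d S"
proof -
  obtain c1 p1 c2 p2 where im: "cluster_of ` S = {(c1, p1), (c2, p2)}" and ne: "(c1, p1) \<noteq> (c2, p2)"
    using S(3) by (auto simp: card_2_iff)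
  define X where "X c p = {q. (c, p, q) \<in> S}" for c p
  let ?T = "\<lambda>c p. Pair c ` Pair p ` X c p"
  have eq: "S = ?T c1 p1 \<union> ?T c2 p2"
  proof
    show "?T c1 p1 \<union> ?T c2 p2 \<subseteq> S"
      by (auto simp: X_def)
    show "S \<subseteq> ?T c1 p1 \<union> ?T c2 p2"
    proof
      fix v assume v: "v \<in> S"
      obtain c p q where [simp]: "v = (c, p, q)"
        by (cases v)
      have "(c, p) \<in> {(c1, p1), (c2, p2)}"
        using imageI[OF v, of cluster_of] im by (simp add: cluster_of_def)
      then show "v \<in> ?T c1 p1 \<union> ?T c2 p2"
        using v by (auto simp: X_def)
    qed
  qed
  have "finite S"
    using S(2) card.infinite by fastforce
  have cardT: "card (?T c p) = card (X c p)" for c p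
    by (simp add: card_image inj_on_def)
  have finT: "finite (?T c p)" for c p
    by (rule finite_subset[OF _ \<open>finite S\<close>]) (auto simp: X_def)
  have "?T c1 p1 \<inter> ?T c2 p2 = {}"
    using ne by auto
  then have sum: "card (X c1 p1) + card (X c2 p2) = 4"
    using card_Un_disjoint[OF finT finT, of c1 p1 c2 p2] eq S(2) cardT by simp
  have pos: "0 < card (X c p)" if "(c, p) \<in> cluster_of ` S" for c p
  proof -
    have "?T c p \<noteq> {}"
      using that by (auto simp: cluster_of_def X_def)
    then show ?thesis
      using finT[of c p] cardT[of c p] card_gt_0_iff by metis
  qed
  have pos1: "0 < card (X c1 p1)" and pos2: "0 < card (X c2 p2)"
    using pos im by auto
  have p: "p1 \<subseteq> {..<d}" "p2 \<subseteq> {..<d}"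
  proof -
    have "p \<subseteq> {..<d}" if "(c, p) \<in> cluster_of ` S" for c p
      using that S(1) by (auto simp: cluster_of_def dual_verts_def)
    from this[of c1 p1] this[of c2 p2] show "p1 \<subseteq> {..<d}" "p2 \<subseteq> {..<d}"
      using im by simp_all
  qed
  have X: "X c p \<subseteq> Pow {..<d}" for c p
    using S(1) by (auto simp: X_def dual_verts_def)
  \<comment> \<open>Each cluster holds at least one of the four vertices, which leaves 3+1 and 2+2
    up to exchanging the clusters.\<close>
  consider "card (X c1 p1) = 3 \<and> card (X c2 p2) = 1 \<or> card (X c1 p1) = 2 \<and> card (X c2 p2) = 2"
    | "card (X c2 p2) = 3 \<and> card (X c1 p1) = 1 \<or> card (X c2 p2) = 2 \<and> card (X c1 p1) = 2"
    using sum pos1 pos2 by linarith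
  then show ?thesis
  proof cases
    case 1
    show ?thesis
      by (subst eq) (rule packable_two_clusters[OF d p ne X X 1])
  next
    case 2
    have "packable d (?T c2 p2 \<union> ?T c1 p1)"
      by (rule packable_two_clusters[OF d p(2,1) ne[symmetric] X X 2])
    then show ?thesis
      by (subst eq) (simp add: Un_commute)
  qed
qed

subsection \<open>Encoding vertices as bit strings\<close>

text \<open>With \<open>n = d + 1\<close>, the low half of the bits varies within a cluster of class
  0 and the high half within one of class 1. So the position \<open>q\<close> is stored low for
  class 0 and high for class 1, and \<open>p\<close> in the other half.\<close>

definition enc :: "nat \<Rightarrow> vertex \<Rightarrow> bool list" where
  "enc d v = (case v of (c, p, q) \<Rightarrow>
     map (\<lambda>i. if i < d then i \<in> (if c then p else q)
       else if i < 2 * d then i - d \<in> (if c then q else p) else c) [0..<2 * d + 1])"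

lemma length_enc [simp]: "length (enc d v) = 2 * d + 1"
  by (simp add: enc_def split: prod.split)

lemma enc_in_dc_verts: "enc d v \<in> dc_verts (Suc d)"
  by (simp add: dc_verts_def)

lemma bit_enc:
  "i \<in> {1..d} \<Longrightarrow> bit (enc d (c, p, q)) i \<longleftrightarrow> i - 1 \<in> (if c then p else q)"
  "i \<in> {d + 1..2 * d} \<Longrightarrow> bit (enc d (c, p, q)) i \<longleftrightarrow> i - 1 - d \<in> (if c then q else p)"
  "bit (enc d (c, p, q)) (2 * d + 1) \<longleftrightarrow> c"
  by (auto simp: bit_def enc_def nth_append simp del: upt_Suc)

lemma bit_enc_low: "j < d \<Longrightarrow> bit (enc d (c, p, q)) (j + 1) \<longleftrightarrow> j \<in> (if c then p else q)"
  and bit_enc_high: "j < d \<Longrightarrow> bit (enc d (c, p, q)) (d + j + 1) \<longleftrightarrow> j \<in> (if c then q else p)"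
  using bit_enc(1)[of "j + 1" d c p q] bit_enc(2)[of "d + j + 1" d c p q] by simp_all

lemma bit_index_cases:
  fixes i d :: nat
  assumes "i \<in> {1..2 * d + 1}"
  obtains j where "j < d" "i = j + 1" | j where "j < d" "i = d + j + 1" | "i = 2 * d + 1"
proof -
  consider "i \<le> d" | "d < i \<and> i \<le> 2 * d" | "i = 2 * d + 1"
    using assms by force
  then show thesis
  proof cases
    case 1
    then show thesis
      using that(1)[of "i - 1"] assms by simp
  next
    case 2
    then have "i - 1 - d < d" "i = d + (i - 1 - d) + 1"
      by linarith+
    then show thesis
      by (rule that(2))
  qed (rule that(3))
qed

lemma inj_on_enc: "inj_on (enc d) (dual_verts d)"
proof (rule inj_onI)
  fix u v assume uv: "u \<in> dual_verts d" "v \<in> dual_verts d" "enc d u = enc d v"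
  obtain c p q c' p' q' where eq: "u = (c, p, q)" "v = (c', p', q')"
    by (cases u, cases v)
  have sub: "p \<subseteq> {..<d}" "q \<subseteq> {..<d}" "p' \<subseteq> {..<d}" "q' \<subseteq> {..<d}"
    using uv eq by (auto simp: dual_verts_def)
  have c: "c = c'"
    using bit_enc(3)[of d c p q] bit_enc(3)[of d c' p' q'] uv(3) eq by simp
  have "j \<in> (if c then p else q) \<longleftrightarrow> j \<in> (if c then p' else q')"
    "j \<in> (if c then q else p) \<longleftrightarrow> j \<in> (if c then q' else p')" if "j < d" for j
    using bit_enc_low[OF that, of c p q] bit_enc_low[OF that, of c' p' q']
      bit_enc_high[OF that, of c p q] bit_enc_high[OF that, of c' p' q'] uv(3) eq c by simp_all
  then have "j \<in> p \<longleftrightarrow> j \<in> p'" "j \<in> q \<longleftrightarrow> j \<in> q'" if "j < d" for j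
    using that by (cases c; simp)+
  then show "u = v"
    using eq c sub by blast
qed

lemma enc_surj:
  assumes "u \<in> dc_verts (Suc d)"
  shows "u \<in> enc d ` dual_verts d"
proof -
  \<comment> \<open>The last bit decides which of the halves \<open>?a\<close> and \<open>?b\<close>
    is the index and which the position.\<close>
  let ?c = "u ! (2 * d)" and ?a = "{i. i < d \<and> u ! i}" and ?b = "{i. i < d \<and> u ! (d + i)}"
  let ?v = "(?c, if ?c then ?a else ?b, if ?c then ?b else ?a)"
  have "u = enc d ?v"
  proof (rule nth_equalityI)
    show "length u = length (enc d ?v)"
      using assms by (simp add: dc_verts_def)
    fix i assume "i < length u"
    then have i: "i < 2 * d + 1"
      using assms by (simp add: dc_verts_def)
    consider "i < d" | "d \<le> i" "i < 2 * d" | "i = 2 * d"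
      using i by linarith
    then show "u ! i = enc d ?v ! i"
      by cases (auto simp: enc_def simp del: upt_Suc)
  qed
  moreover have "?v \<in> dual_verts d"
    by (auto simp: dual_verts_def)
  ultimately show ?thesis
    by (rule image_eqI)
qed

text \<open>Along a cross edge the exchange of \<open>p\<close> and \<open>q\<close> cancels the
  exchange of halves, so only the last bit changes. Inside a cluster one bit changes in the half
  that holds the position, as the class demands.\<close>

lemma dc_adj_enc:
  assumes "dual_adj d u v" "u \<in> dual_verts d" "v \<in> dual_verts d"
  shows "dc_adj (Suc d) (enc d u) (enc d v)"
proof -
  obtain c p q c' p' q' where eq: "u = (c, p, q)" "v = (c', p', q')"
    by (cases u, cases v)
  note bits = bit_enc_low[simplified] bit_enc_high[simplified] bit_enc(3)[simplified]
  have "\<exists>i\<in>{1..2 * d + 1}. bit (enc d u) i \<noteq> bit (enc d v) i \<and>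
      (\<forall>j\<in>{1..2 * d + 1}. j \<noteq> i \<longrightarrow> bit (enc d u) j = bit (enc d v) j) \<and>
      (1 \<le> i \<and> i \<le> d \<longrightarrow> \<not> bit (enc d u) (2 * d + 1) \<and> \<not> bit (enc d v) (2 * d + 1)) \<and>
      (Suc d \<le> i \<and> i \<le> 2 * d \<longrightarrow> bit (enc d u) (2 * d + 1) \<and> bit (enc d v) (2 * d + 1))"
  proof (cases "c' = c")
    case True
    then obtain k where k: "k < d" "p' = p" "q' = flip k q"
      using assms(1) eq by (auto simp: dual_adj_def cube_adj_def)
    have mem: "(j \<in> flip k q) = (j \<in> q) \<longleftrightarrow> j \<noteq> k" for j
      by (auto simp: flip_def)
    define i where "i = (if c then d + k + 1 else k + 1)"
    have "bit (enc d u) j = bit (enc d v) j \<longleftrightarrow> j \<noteq> i" if "j \<in> {1..2 * d + 1}" for j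
      using that
    proof (cases rule: bit_index_cases)
      case (1 l)
      then show ?thesis
        using mem[of l] eq True k by (cases c) (auto simp: bits i_def)
    next
      case (2 l)
      then show ?thesis
        using mem[of l] eq True k by (cases c) (auto simp: bits i_def)
    next
      case 3
      then show ?thesis
        using eq True k by (auto simp: bits i_def)
    qed
    moreover have "i \<in> {1..2 * d + 1}" "c \<Longrightarrow> \<not> i \<le> d" "\<not> c \<Longrightarrow> \<not> Suc d \<le> i"
      using k(1) by (auto simp: i_def)
    ultimately show ?thesis
      using eq True bits(3)[of d c p q] bits(3)[of d c' p' q'] by (intro bexI[of _ i]) auto
  next
    case False
    then have k: "c' = (\<not> c)" "p' = q" "q' = p"
      using assms(1) eq by (auto simp: dual_adj_def)
    have "bit (enc d u) j = bit (enc d v) j \<longleftrightarrow> j \<noteq> 2 * d + 1" if "j \<in> {1..2 * d + 1}" for j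
      using that
    proof (cases rule: bit_index_cases)
      case (1 l)
      then show ?thesis
        using eq k by (auto simp: bits)
    next
      case (2 l)
      then show ?thesis
        using eq k by (auto simp: bits)
    next
      case 3
      then show ?thesis
        using eq k bits(3)[of d c p q] bits(3)[of d c' p' q'] by simp
    qed
    then show ?thesis
      by (intro bexI[of _ "2 * d + 1"]) auto
  qed
  then show ?thesis
    by (simp add: dc_adj_def enc_in_dc_verts)
qed

text \<open>The bits fixed in a cluster are the last one, which is the class, and the half that
  stores \<open>p\<close>.\<close>

lemma cluster_enc:
  assumes "u \<in> dual_verts d"
  shows "cluster (Suc d) (enc d u) = enc d ` {v \<in> dual_verts d. cluster_of v = cluster_of u}"
proof -
  have "enc d v \<in> cluster (Suc d) (enc d u) \<longleftrightarrow> cluster_of v = cluster_of u"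
    if v: "v \<in> dual_verts d" for v
  proof -
    obtain c p q c' p' q' where eq: "u = (c, p, q)" "v = (c', p', q')"
      by (cases u, cases v)
    have sub: "p \<subseteq> {..<d}" "p' \<subseteq> {..<d}"
      using assms v eq by (auto simp: dual_verts_def)
    have low: "(\<forall>i\<in>{1..d}. bit (enc d v) i = bit (enc d u) i) \<longleftrightarrow> p' = p" if "c" "c'"
    proof
      assume *: "\<forall>i\<in>{1..d}. bit (enc d v) i = bit (enc d u) i"
      have "j \<in> p' \<longleftrightarrow> j \<in> p" if "j < d" for j
        using *[rule_format, of "j + 1"] that \<open>c\<close> \<open>c'\<close> eq
          bit_enc_low[OF that, of c p q] bit_enc_low[OF that, of c' p' q'] by simp
      then show "p' = p"
        using sub by blast
    qed (use that eq in \<open>auto simp: bit_enc(1)\<close>)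
    have high: "(\<forall>i\<in>{d + 1..2 * d}. bit (enc d v) i = bit (enc d u) i) \<longleftrightarrow> p' = p" if "\<not> c" "\<not> c'"
    proof
      assume *: "\<forall>i\<in>{d + 1..2 * d}. bit (enc d v) i = bit (enc d u) i"
      have "j \<in> p' \<longleftrightarrow> j \<in> p" if "j < d" for j
        using *[rule_format, of "d + j + 1"] that \<open>\<not> c\<close> \<open>\<not> c'\<close> eq
          bit_enc_high[OF that, of c p q] bit_enc_high[OF that, of c' p' q'] by simp
      then show "p' = p"
        using sub by blast
    qed (use that eq in \<open>auto simp: bit_enc(2)\<close>)
    show ?thesis
      using low high bit_enc(3)[of d c p q] bit_enc(3)[of d c' p' q'] eq
      by (cases c; cases c') (simp_all add: cluster_def enc_in_dc_verts cluster_of_def)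
  qed
  moreover have "cluster (Suc d) (enc d u) \<subseteq> enc d ` dual_verts d"
    using enc_surj by (auto simp: cluster_def)
  ultimately show ?thesis
    by blast
qed

text \<open>The fibres of \<open>cluster_of\<close> that occur are nonempty and \<open>enc\<close>
  is injective, so different fibres have different images.\<close>

lemma card_clusters_enc:
  assumes "S \<subseteq> dual_verts d"
  shows "card (cluster (Suc d) ` enc d ` S) = card (cluster_of ` S)"
proof -
  let ?g = "\<lambda>k. enc d ` {v \<in> dual_verts d. cluster_of v = k}"
  have "cluster (Suc d) ` enc d ` S = ?g ` cluster_of ` S"
    unfolding image_image using assms by (intro image_cong) (auto simp: cluster_enc)
  moreover have "inj_on ?g (cluster_of ` S)"
  proof (rule inj_onI)
    fix k l assume k: "k \<in> cluster_of ` S" and eq: "?g k = ?g l"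
    obtain u where u: "u \<in> S" "k = cluster_of u"
      using k by blast
    then have "enc d u \<in> ?g l"
      using assms unfolding eq[symmetric] by auto
    then obtain v where v: "v \<in> dual_verts d" "cluster_of v = l" "enc d u = enc d v"
      by blast
    then have "u = v"
      using inj_onD[OF inj_on_enc v(3)] u(1) assms by blast
    then show "k = l"
      using u(2) v(2) by simp
  qed
  ultimately show ?thesis
    by (simp add: card_image)
qed

section \<open>From connected pieces to disjoint trees\<close>

lemma dc_adj_irrefl: "dc_adj n u v \<Longrightarrow> u \<noteq> v"
  by (auto simp: dc_adj_def)

text \<open>A spanning tree of a piece keeps its vertices and uses only its edges, so disjointness
  is inherited.\<close>

lemma system_S_trees:
  assumes s: "system (dc_adj n) (dc_verts n) m S W A" and "S \<noteq> {}"
    and conn: "\<And>i u v. i < m \<Longrightarrow> u \<in> S \<union> W i \<Longrightarrow> v \<in> S \<union> W i \<Longrightarrow> reach (A i) u v"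
  shows "\<exists>TV TE. internally_disjoint_S_trees n S m TV TE"
proof -
  have S: "S \<subseteq> dc_verts n" and W: "\<And>i. i < m \<Longrightarrow> W i \<subseteq> dc_verts n - S"
    and A: "\<And>i. i < m \<Longrightarrow> A i \<subseteq> {{u, v} | u v. dc_adj n u v \<and> u \<in> S \<union> W i \<and> v \<in> S \<union> W i}"
    and d: "\<And>i j. i < m \<Longrightarrow> j < m \<Longrightarrow> i \<noteq> j \<Longrightarrow> W i \<inter> W j = {} \<and> A i \<inter> A j = {}"
    using s by (simp_all add: system_def)
  have fin: "finite (dc_verts n)"
    using finite_lists_length_eq[of "UNIV :: bool set"] by (simp add: dc_verts_def)
  have "\<exists>T\<subseteq>A i. is_tree (S \<union> W i) T" if i: "i < m" for i
  proof (rule spanning_tree_exists)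
    show "finite (S \<union> W i)"
      using S W[OF i] fin by (meson Diff_subset finite_subset le_sup_iff order_trans)
    show "connected_graph (S \<union> W i) (A i)"
      using conn[OF i] \<open>S \<noteq> {}\<close> by (simp add: connected_graph_reach)
    show "\<exists>u v. u \<noteq> v \<and> e = {u, v} \<and> u \<in> S \<union> W i \<and> v \<in> S \<union> W i" if e: "e \<in> A i" for e
    proof -
      obtain u v where "e = {u, v}" "dc_adj n u v" "u \<in> S \<union> W i" "v \<in> S \<union> W i"
        using subsetD[OF A[OF i] e] by blast
      then show ?thesis
        using dc_adj_irrefl by (intro exI[of _ u] exI[of _ v]) simp
    qed
  qed
  then have "\<exists>T. \<forall>i<m. T i \<subseteq> A i \<and> is_tree (S \<union> W i) (T i)"
    by (intro choice) blast
  then obtain T where T: "\<And>i. i < m \<Longrightarrow> T i \<subseteq> A i" "\<And>i. i < m \<Longrightarrow> is_tree (S \<union> W i) (T i)"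
    by blast
  have "A i \<subseteq> dc_edges n" if "i < m" for i
    by (rule order_trans[OF A[OF that]]) (auto simp: dc_edges_def)
  then have "is_S_tree n S (S \<union> W i) (T i)" if "i < m" for i
    using T[OF that] S W[OF that] that by (auto simp: is_S_tree_def)
  moreover have "T i \<inter> T j = {} \<and> (S \<union> W i) \<inter> (S \<union> W j) = S" if "i < m" "j < m" "i \<noteq> j" for i j
    using d[OF that] T(1)[OF that(1)] T(1)[OF that(2)] by blast
  ultimately show ?thesis
    unfolding internally_disjoint_S_trees_def
    by (intro exI[of _ "\<lambda>i. S \<union> W i"] exI[of _ T]) simp
qed

theorem mainTheorem3:
  fixes n :: nat and x y z w :: "bool list"
  assumes "n \<ge> 4"
    and "x \<in> dc_verts n" "y \<in> dc_verts n" "z \<in> dc_verts n" "w \<in> dc_verts n"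
    and "distinct [x, y, z, w]"
    and "card (cluster n ` {x, y, z, w}) = 2"
  shows "\<exists>TV TE. internally_disjoint_S_trees n {x, y, z, w} (n - 1) TV TE"
proof -
  obtain d where n: "n = Suc d"
    using assms(1) by (cases n) auto
  \<comment> \<open>The four vertices are pulled back along \<open>enc\<close>, packed in the model
    with \<open>d = n - 1\<close> pieces, and the system is pushed forward again.\<close>
  have "{x, y, z, w} \<subseteq> enc d ` dual_verts d"
    using assms(2-5) enc_surj n by simp
  then obtain S where S: "S \<subseteq> dual_verts d" "{x, y, z, w} = enc d ` S"
    by (meson subset_imageE)
  have "inj_on (enc d) S"
    using inj_on_enc S(1) by (rule inj_on_subset)
  then have "card S = 4"
    using card_image[of "enc d" S] S(2)[symmetric] assms(6) by simp
  moreover have "card (cluster_of ` S) = 2"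
    using card_clusters_enc[OF S(1)] assms(7) S(2) n by simp
  ultimately have "packable d S"
    using assms(1) n S(1) by (intro packable_four) simp_all
  then obtain W A where s: "system (dual_adj d) (dual_verts d) d S W A"
    and conn: "\<And>i u v. i < d \<Longrightarrow> u \<in> S \<union> W i \<Longrightarrow> v \<in> S \<union> W i \<Longrightarrow> reach (A i) u v"
    unfolding packable_def by blast
  have "\<exists>TV TE. internally_disjoint_S_trees (Suc d) (enc d ` S) d TV TE"
  proof (rule system_S_trees)
    show "system (dc_adj (Suc d)) (dc_verts (Suc d)) d (enc d ` S) (\<lambda>i. enc d ` W i)
        (\<lambda>i. (`) (enc d) ` A i)"
      by (rule system_image[OF s inj_on_enc]) (auto intro: enc_in_dc_verts dc_adj_enc)
    show "enc d ` S \<noteq> {}"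
      using S(2) by blast
    fix i u v assume i: "i < d" and "u \<in> enc d ` S \<union> enc d ` W i" "v \<in> enc d ` S \<union> enc d ` W i"
    then obtain u' v' where "u = enc d u'" "v = enc d v'" "u' \<in> S \<union> W i" "v' \<in> S \<union> W i"
      by blast
    then show "reach ((`) (enc d) ` A i) u v"
      using reach_image[OF conn[OF i], of u' v' "enc d"] by simp
  qed
  then show ?thesis
    using S(2) n by simp
qed

end
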